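(* Let $\mu$ be a Borel probability measure on $\mathbb{R}$ and $(s_t)_{t>0}$ kernels satisfying the assumptions in the context for some $0<m<1$, such that the conical square function $S$ is bounded on $L^2(\mu)$ but $S_\beta(1)\notin L^2(\mu)$ for any $\beta>1$. If $V$ is the vertical square function operator associated with the same kernels and measure, then $V(1)\notin L^2(\mu)$. In particular, the boundedness of $S$ on $L^2(\mu)$ does not imply the boundedness of $V$ on $L^2(\mu)$: there exist a Borel probability measure $\mu$ on $\mathbb{R}$ and kernels $(s_t)_{t>0}$ satisfying these assumptions for which $S$ is bounded on $L^2(\mu)$ while $V$ is not.
   Context: Assumptions for some $0<m<1$ and $\alpha>0$: $\mu(B(x,r))\lesssim r^m$ for all $x\in\mathbb{R}$, $r>0$; $|s_t(x,y)|\lesssim\frac{t^\alpha}{(t+|x-y|)^{m+\alpha}}$ for all $x,y\in\mathbb{R}$, $t>0$; and $|s_t(x,y)-s_t(x,z)|\lesssim\frac{|y-z|^\alpha}{(t+|x-y|)^{m+\alpha}}$ whenever $|y-z|<t/2$. Here $A\lesssim B$ means $A\le CB$ with a finite constant $C$ independent of $x,y,z,t,r$. Set $\theta_tf(x)=\int_{\mathbb{R}}s_t(x,y)f(y)\,d\mu(y)$. For $\beta>0$ let $\Gamma_\beta(x)=\{(y,t)\in\mathbb{R}\times(0,\infty):|y-x|<\beta t\}$, $$S_\beta f(x)=\left(\iint_{\Gamma_\beta(x)}|\theta_tf(y)|^2\,\frac{d\mu(y)\,dt}{t^{m+1}}\right)^{1/2},\qquad S=S_1,\qquad Vf(x)=\left(\int_0^\infty|\theta_tf(x)|^2\frac{dt}{t}\right)^{1/2}.$$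 Here $1$ denotes the constant function. *)

theory Defs
  imports "HOL-Probability.Probability_Measure"
begin

text \<open>
  Square functions take values in \<^typ>\<open>ennreal\<close>, so that they and their \<open>L\<^sup>2\<close> norms are
  meaningful even where they are infinite. The library has no square root on \<^typ>\<open>ennreal\<close>.
\<close>

definition ennreal_sqrt :: "ennreal \<Rightarrow> ennreal" where
  "ennreal_sqrt x = (if x = \<infinity> then \<infinity> else ennreal (sqrt (enn2real x)))"

definition L2_norm :: "real measure \<Rightarrow> (real \<Rightarrow> ennreal) \<Rightarrow> ennreal" where
  "L2_norm \<mu> g = ennreal_sqrt (\<integral>\<^sup>+x. (g x)\<^sup>2 \<partial>\<mu>)"

definition in_L2 :: "real measure \<Rightarrow> (real \<Rightarrow> ennreal) \<Rightarrow> bool" where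
  "in_L2 \<mu> g \<longleftrightarrow> g \<in> borel_measurable \<mu> \<and> L2_norm \<mu> g < \<infinity>"

definition bounded_on_L2 :: "real measure \<Rightarrow> ((real \<Rightarrow> complex) \<Rightarrow> real \<Rightarrow> ennreal) \<Rightarrow> bool" where
  "bounded_on_L2 \<mu> T \<longleftrightarrow>
     (\<exists>C::real. \<forall>f \<in> borel_measurable \<mu>. L2_norm \<mu> (\<lambda>x. ennreal (cmod (f x))) < \<infinity> \<longrightarrow>
        L2_norm \<mu> (T f) \<le> ennreal C * L2_norm \<mu> (\<lambda>x. ennreal (cmod (f x))))"

text \<open>
  A kernel family is \<open>s t x y\<close>; only its values for \<open>t > 0\<close> are ever used. Joint Borel
  measurability is the standing convention under which the integrals below make sense.
\<close>

definition growth_condition :: "real \<Rightarrow> real measure \<Rightarrow> bool" where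
  "growth_condition m \<mu> \<longleftrightarrow>
     (\<exists>C::real. \<forall>x r. r > 0 \<longrightarrow> measure \<mu> (ball x r) \<le> C * r powr m)"

definition measurable_kernels :: "(real \<Rightarrow> real \<Rightarrow> real \<Rightarrow> complex) \<Rightarrow> bool" where
  "measurable_kernels s \<longleftrightarrow>
     (\<lambda>(t, x, y). s t x y) \<in> borel_measurable (restrict_space borel ({0<..} \<times> UNIV))"

definition size_condition :: "real \<Rightarrow> real \<Rightarrow> (real \<Rightarrow> real \<Rightarrow> real \<Rightarrow> complex) \<Rightarrow> bool" where
  "size_condition m \<alpha> s \<longleftrightarrow>
     (\<exists>C::real. \<forall>x y t. t > 0 \<longrightarrow>
        cmod (s t x y) \<le> C * (t powr \<alpha> / (t + \<bar>x - y\<bar>) powr (m + \<alpha>)))"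

definition holder_condition :: "real \<Rightarrow> real \<Rightarrow> (real \<Rightarrow> real \<Rightarrow> real \<Rightarrow> complex) \<Rightarrow> bool" where
  "holder_condition m \<alpha> s \<longleftrightarrow>
     (\<exists>C::real. \<forall>x y z t. t > 0 \<and> \<bar>y - z\<bar> < t / 2 \<longrightarrow>
        cmod (s t x y - s t x z) \<le> C * (\<bar>y - z\<bar> powr \<alpha> / (t + \<bar>x - y\<bar>) powr (m + \<alpha>)))"

definition standing_assumptions ::
    "real \<Rightarrow> real \<Rightarrow> real measure \<Rightarrow> (real \<Rightarrow> real \<Rightarrow> real \<Rightarrow> complex) \<Rightarrow> bool" where
  "standing_assumptions m \<alpha> \<mu> s \<longleftrightarrow>
     0 < m \<and> m < 1 \<and> 0 < \<alpha> \<and>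
     prob_space \<mu> \<and> sets \<mu> = sets borel \<and> growth_condition m \<mu> \<and>
     measurable_kernels s \<and> size_condition m \<alpha> s \<and> holder_condition m \<alpha> s"

definition theta ::
    "real measure \<Rightarrow> (real \<Rightarrow> real \<Rightarrow> real \<Rightarrow> complex) \<Rightarrow> real \<Rightarrow> (real \<Rightarrow> complex) \<Rightarrow> real \<Rightarrow> complex" where
  "theta \<mu> s t f x = (\<integral>y. s t x y * f y \<partial>\<mu>)"

definition cone :: "real \<Rightarrow> real \<Rightarrow> (real \<times> real) set" where
  "cone \<beta> x = {(y, t). 0 < t \<and> \<bar>y - x\<bar> < \<beta> * t}"

definition conical_sf ::
    "real \<Rightarrow> real measure \<Rightarrow> (real \<Rightarrow> real \<Rightarrow> real \<Rightarrow> complex) \<Rightarrow> real \<Rightarrow>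
     (real \<Rightarrow> complex) \<Rightarrow> real \<Rightarrow> ennreal" where
  "conical_sf m \<mu> s \<beta> f x =
     ennreal_sqrt (\<integral>\<^sup>+(y, t) \<in> cone \<beta> x.
       ennreal ((cmod (theta \<mu> s t f y))\<^sup>2 / t powr (m + 1)) \<partial>(\<mu> \<Otimes>\<^sub>M lborel))"

definition vertical_sf ::
    "real measure \<Rightarrow> (real \<Rightarrow> real \<Rightarrow> real \<Rightarrow> complex) \<Rightarrow> (real \<Rightarrow> complex) \<Rightarrow> real \<Rightarrow> ennreal" where
  "vertical_sf \<mu> s f x =
     ennreal_sqrt (\<integral>\<^sup>+t \<in> {0<..}. ennreal ((cmod (theta \<mu> s t f x))\<^sup>2 / t) \<partial>lborel)"

end

theory Submission
  imports Defs
begin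

text \<open>
  Averaging the conical square function over its vertices gives, by Tonelli,
  \<open>\<integral> |S\<^sub>\<beta> f|\<^sup>2 d\<mu> = \<integral> \<integral> |\<theta>\<^sub>t f(y)|\<^sup>2 \<mu>(B(y, \<beta>t)) / t\<^sup>m d\<mu>(y) dt/t\<close> (\<open>nn_integral_conical_sf\<close>), while the
  vertical one gives the same integral without the weight \<open>\<mu>(B(y, \<beta>t)) / t\<^sup>m\<close>. Growth bounds the
  weight, so \<open>V(1) \<in> L\<^sup>2\<close> implies \<open>S\<^sub>\<beta>(1) \<in> L\<^sup>2\<close> for every \<open>\<beta>\<close>
  (\<open>conical_in_L2_if_vertical_in_L2\<close>). That is the first claim.

  For the second claim the weight must be small at many scales \<open>t\<close> at which \<open>\<theta>\<^sub>t\<close> is not small. On the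
  line this requires \<open>\<theta>\<^sub>t\<close> to look at a distance \<open>h(t)\<close> much larger than \<open>t\<close>. Let
  \<open>m = \<alpha> = 1/2\<close> and let \<open>s\<^sub>t\<close> be a tent of height \<open>\<surd>t / h(t)\<close>, supported on \<open>|x - y| \<le> 2 h(t)\<close>. If
  \<open>\<mu>(B(x, h(t)))\<close> is of the maximal order \<open>\<surd>h(t)\<close>, then \<open>|\<theta>\<^sub>t 1|\<^sup>2\<close> and the operator norm squared of \<open>\<theta>\<^sub>t\<close>
  are both of order \<open>t / h(t)\<close> (\<open>theta_tent_one_ge\<close>, \<open>theta_tent_L2_bound\<close>). If moreover \<open>\<mu>\<close> is
  distributed like a multiple of Lebesgue measure between the lengths \<open>t\<close> and \<open>h(t)\<close>, then
  \<open>\<mu>(B(x, t))\<close> is of order \<open>t / \<surd>h(t)\<close> and the weight is of order \<open>\<surd>(t / h(t))\<close>. Choose countably many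
  disjoint windows \<open>A\<^sub>j\<close> of scales of logarithmic length of order 1, with \<open>t / h(t)\<close> of order
  \<open>1 / (j+1)\<close> on \<open>A\<^sub>j\<close>, and let the kernel vanish at all other scales. Then \<open>V(1)\<^sup>2\<close> dominates
  the harmonic series almost everywhere, whereas the operator norm of \<open>S\<close> squared is controlled by the
  convergent series of \<open>(j+1)\<close> to the power \<open>-3/2\<close> (\<open>vertical_scale_integral_infinite\<close>,
  \<open>conical_scale_integral_finite\<close>).

  A measure with these properties is the law of a random binary expansion in which the digits at
  certain positions are independent and uniform and all others vanish. The free positions come in
  runs, the \<open>j\<close>-th run of length \<open>j + 1\<close>, separated by gaps of the same length: at the start of each run
  half of the digits are free, which makes the measure thick (\<open>AE_long_runs_measure_thick\<close>), and inside
  a run the measure is a multiple of Lebesgue measure at the relevant resolution, which makes it thin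
  (\<open>long_runs_measure_thin\<close>).
\<close>

section \<open>Square roots of extended nonnegative reals\<close>

lemma ennreal_sqrt_power2 [simp]: "(ennreal_sqrt x)\<^sup>2 = x"
  by (cases x) (auto simp: ennreal_sqrt_def ennreal_power power_eq_top_ennreal)

lemma ennreal_sqrt_less_top_iff: "ennreal_sqrt x < top \<longleftrightarrow> x < top"
  by (cases x) (auto simp: ennreal_sqrt_def)

lemma ennreal_sqrt_mono: "x \<le> y \<Longrightarrow> ennreal_sqrt x \<le> ennreal_sqrt y"
  by (cases x; cases y) (auto simp: ennreal_sqrt_def top_unique)

lemma ennreal_sqrt_mult_power2: "0 \<le> C \<Longrightarrow> ennreal_sqrt (ennreal (C\<^sup>2) * x) = ennreal C * ennreal_sqrt x"
  by (cases x; cases "C = 0")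
     (auto simp: ennreal_sqrt_def ennreal_mult[symmetric] real_sqrt_mult ennreal_mult_top)

lemma measurable_ennreal_sqrt [measurable]: "ennreal_sqrt \<in> borel_measurable borel"
  unfolding ennreal_sqrt_def by measurable

section \<open>Conical and vertical square functions compared by Tonelli\<close>

text \<open>
  A measurable kernel family is constrained for \<open>t > 0\<close> only, so the joint measurability of
  \<open>\<theta>\<^sub>t f(x)\<close> in \<open>(t, x)\<close> is stated after cutting off \<open>t \<le> 0\<close>.
\<close>

lemma measurable_theta:
  assumes "sigma_finite_measure \<mu>" and sets: "sets \<mu> = sets borel"
    and s: "measurable_kernels s" and f [measurable]: "f \<in> borel_measurable \<mu>"
  shows "(\<lambda>(t, x). indicator {0<..} t *\<^sub>R theta \<mu> s t f x) \<in> borel_measurable (lborel \<Otimes>\<^sub>M \<mu>)"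
proof -
  interpret sigma_finite_measure \<mu> by fact
  note [measurable_cong] = sets
  have [measurable]: "f \<in> borel_measurable borel"
    using f by (simp add: measurable_cong_sets[OF sets refl])
  have "(\<lambda>p. indicator ({0<..} \<times> UNIV) p *\<^sub>R (case p of (t, x, y) \<Rightarrow> s t x y)) \<in> borel_measurable borel"
    using s unfolding measurable_kernels_def
    by (subst (asm) borel_measurable_restrict_space_iff) (simp_all add: borel_open open_Times)
  then have [measurable]: "(\<lambda>p. indicator ({0<..} \<times> UNIV) p *\<^sub>R (case p of (t, x, y) \<Rightarrow> s t x y))
      \<in> borel_measurable (borel \<Otimes>\<^sub>M (borel \<Otimes>\<^sub>M borel))"
    by (simp add: borel_prod)
  have "(\<lambda>p. indicator ({0<..} \<times> UNIV) (fst (fst p), snd (fst p), snd p)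
          *\<^sub>R (case (fst (fst p), snd (fst p), snd p) of (t, x, y) \<Rightarrow> s t x y) * f (snd p))
        \<in> borel_measurable ((lborel \<Otimes>\<^sub>M \<mu>) \<Otimes>\<^sub>M \<mu>)"
    by measurable
  also have "(\<lambda>p. indicator ({0<..} \<times> UNIV) (fst (fst p), snd (fst p), snd p)
          *\<^sub>R (case (fst (fst p), snd (fst p), snd p) of (t, x, y) \<Rightarrow> s t x y) * f (snd p))
      = (\<lambda>(p, y). indicator {0<..} (fst p) *\<^sub>R (s (fst p) (snd p) y * f y))"
    by (auto simp: indicator_def fun_eq_iff)
  finally have "(\<lambda>p. \<integral>y. indicator {0<..} (fst p) *\<^sub>R (s (fst p) (snd p) y * f y) \<partial>\<mu>)
      \<in> borel_measurable (lborel \<Otimes>\<^sub>M \<mu>)"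
    by (rule borel_measurable_lebesgue_integral)
  then show ?thesis
    by (simp add: theta_def case_prod_beta)
qed

lemma measurable_theta_density:
  assumes "sigma_finite_measure \<mu>" "sets \<mu> = sets borel" "measurable_kernels s" "f \<in> borel_measurable \<mu>"
  shows "(\<lambda>(t, y). ennreal ((cmod (theta \<mu> s t f y))\<^sup>2 / t powr a) * indicator {0<..} t)
           \<in> borel_measurable (lborel \<Otimes>\<^sub>M \<mu>)"
proof -
  note [measurable] = measurable_theta[OF assms]
  have "(\<lambda>p. ennreal ((cmod ((\<lambda>(t, x). indicator {0<..} t *\<^sub>R theta \<mu> s t f x) p))\<^sup>2 / fst p powr a)
         * indicator {0<..} (fst p)) \<in> borel_measurable (lborel \<Otimes>\<^sub>M \<mu>)"
    by measurable
  also have "(\<lambda>p. ennreal ((cmod ((\<lambda>(t, x). indicator {0<..} t *\<^sub>R theta \<mu> s t f x) p))\<^sup>2 / fst p powr a)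
         * indicator {0<..} (fst p)) =
     (\<lambda>(t, y). ennreal ((cmod (theta \<mu> s t f y))\<^sup>2 / t powr a) * indicator {0<..} t)"
    by (auto simp: indicator_def fun_eq_iff)
  finally show ?thesis .
qed

lemma measurable_conical_integrand:
  assumes \<mu>: "sigma_finite_measure \<mu>" and sets: "sets \<mu> = sets borel"
    and s: "measurable_kernels s" and f: "f \<in> borel_measurable \<mu>"
  shows "(\<lambda>(x, y, t). ennreal ((cmod (theta \<mu> s t f y))\<^sup>2 / t powr a) * indicator (cone \<beta> x) (y, t))
           \<in> borel_measurable (\<mu> \<Otimes>\<^sub>M (\<mu> \<Otimes>\<^sub>M lborel))"
proof -
  note [measurable] = measurable_theta_density[OF assms]
  note [measurable_cong] = sets
  have "(\<lambda>p. (\<lambda>(t, y). ennreal ((cmod (theta \<mu> s t f y))\<^sup>2 / t powr a) * indicator {0<..} t)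
              (snd (snd p), fst (snd p))
           * indicator {p. \<bar>fst (snd p) - fst p\<bar> < \<beta> * snd (snd p)} p)
           \<in> borel_measurable (\<mu> \<Otimes>\<^sub>M (\<mu> \<Otimes>\<^sub>M lborel))"
    by measurable
  also have "(\<lambda>p. (\<lambda>(t, y). ennreal ((cmod (theta \<mu> s t f y))\<^sup>2 / t powr a) * indicator {0<..} t)
              (snd (snd p), fst (snd p))
           * indicator {p. \<bar>fst (snd p) - fst p\<bar> < \<beta> * snd (snd p)} p) =
      (\<lambda>(x, y, t). ennreal ((cmod (theta \<mu> s t f y))\<^sup>2 / t powr a) * indicator (cone \<beta> x) (y, t))"
    by (auto simp: indicator_def cone_def fun_eq_iff)
  finally show ?thesis .
qed

lemma measurable_conical_sf:
  assumes "sigma_finite_measure \<mu>" "sets \<mu> = sets borel" "measurable_kernels s" "f \<in> borel_measurable \<mu>"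
  shows "conical_sf m \<mu> s \<beta> f \<in> borel_measurable \<mu>"
proof -
  interpret pair_sigma_finite \<mu> lborel
    using assms(1) by (intro pair_sigma_finite.intro sigma_finite_lborel)
  interpret P: sigma_finite_measure "\<mu> \<Otimes>\<^sub>M lborel" ..
  note [measurable] = P.borel_measurable_nn_integral_fst[OF measurable_conical_integrand[OF assms]]
  have "conical_sf m \<mu> s \<beta> f = (\<lambda>x. ennreal_sqrt (\<integral>\<^sup>+p. (\<lambda>(x, y, t). ennreal ((cmod (theta \<mu> s t f y))\<^sup>2 / t powr (m + 1))
            * indicator (cone \<beta> x) (y, t)) (x, p) \<partial>(\<mu> \<Otimes>\<^sub>M lborel)))"
    by (simp add: conical_sf_def fun_eq_iff case_prod_beta)
  also have "\<dots> \<in> borel_measurable \<mu>"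
    by measurable
  finally show ?thesis .
qed

text \<open>
  Integrating in the vertex \<open>x\<close> first: for a fixed \<open>(y, t)\<close> the vertices whose cone contains that
  point fill the ball of radius \<open>\<beta>t\<close> about \<open>y\<close>. Both halves of the theorem rest on this identity:
  the conical square function sees \<open>|\<theta>\<^sub>t f(y)|\<^sup>2\<close> with the additional weight
  \<open>\<mu>(B(y, \<beta>t)) / t\<^sup>m\<close>, which growth bounds from above and nothing bounds from below.
\<close>

lemma nn_integral_conical_sf:
  assumes \<mu>: "sigma_finite_measure \<mu>" and sets: "sets \<mu> = sets borel"
    and s: "measurable_kernels s" and f: "f \<in> borel_measurable \<mu>"
  shows "(\<integral>\<^sup>+x. (conical_sf m \<mu> s \<beta> f x)\<^sup>2 \<partial>\<mu>) =
    (\<integral>\<^sup>+t\<in>{0<..}. (\<integral>\<^sup>+y. ennreal ((cmod (theta \<mu> s t f y))\<^sup>2 / t powr (m + 1))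
        * emeasure \<mu> (ball y (\<beta> * t)) \<partial>\<mu>) \<partial>lborel)"
proof -
  let ?G = "\<lambda>t y. ennreal ((cmod (theta \<mu> s t f y))\<^sup>2 / t powr (m + 1))"
  let ?g = "\<lambda>(x, y, t). ?G t y * indicator (cone \<beta> x) (y, t)"
  interpret pair_sigma_finite \<mu> lborel
    using \<mu> by (intro pair_sigma_finite.intro sigma_finite_lborel)
  interpret P: sigma_finite_measure "\<mu> \<Otimes>\<^sub>M lborel" ..
  interpret PP: pair_sigma_finite \<mu> "\<mu> \<Otimes>\<^sub>M lborel" ..
  note g [measurable] = measurable_conical_integrand[OF assms, of "m + 1" \<beta>]
  note [measurable] = M1.borel_measurable_nn_integral_fst
  have ball: "(\<integral>\<^sup>+x. ?g (x, y, t) \<partial>\<mu>) = ?G t y * emeasure \<mu> (ball y (\<beta> * t)) * indicator {0<..} t" for y t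
  proof -
    have "(\<integral>\<^sup>+x. ?g (x, y, t) \<partial>\<mu>)
        = (\<integral>\<^sup>+x. (?G t y * indicator {0<..} t) * indicator (ball y (\<beta> * t)) x \<partial>\<mu>)"
      by (intro nn_integral_cong) (auto simp: cone_def dist_real_def indicator_def)
    also have "\<dots> = (?G t y * indicator {0<..} t) * emeasure \<mu> (ball y (\<beta> * t))"
      by (intro nn_integral_cmult_indicator) (simp add: sets)
    finally show ?thesis
      by (simp add: mult_ac)
  qed
  have "(\<integral>\<^sup>+x. (conical_sf m \<mu> s \<beta> f x)\<^sup>2 \<partial>\<mu>) = (\<integral>\<^sup>+x. (\<integral>\<^sup>+p. ?g (x, p) \<partial>(\<mu> \<Otimes>\<^sub>M lborel)) \<partial>\<mu>)"
    by (simp add: conical_sf_def case_prod_beta)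
  also have "\<dots> = (\<integral>\<^sup>+p. (\<integral>\<^sup>+x. ?g (x, p) \<partial>\<mu>) \<partial>(\<mu> \<Otimes>\<^sub>M lborel))"
    using PP.Fubini[OF g] by simp
  also have "\<dots> = (\<integral>\<^sup>+t. (\<integral>\<^sup>+y. (\<integral>\<^sup>+x. ?g (x, y, t) \<partial>\<mu>) \<partial>\<mu>) \<partial>lborel)"
    by (rule nn_integral_snd[symmetric]) measurable
  also have "\<dots> = (\<integral>\<^sup>+t\<in>{0<..}. (\<integral>\<^sup>+y. ?G t y * emeasure \<mu> (ball y (\<beta> * t)) \<partial>\<mu>) \<partial>lborel)"
    unfolding ball by (intro nn_integral_cong) (auto simp: indicator_def)
  finally show ?thesis .
qed

lemma nn_integral_vertical_sf:
  assumes \<mu>: "sigma_finite_measure \<mu>" and sets: "sets \<mu> = sets borel"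
    and s: "measurable_kernels s" and f: "f \<in> borel_measurable \<mu>"
  shows "(\<integral>\<^sup>+x. (vertical_sf \<mu> s f x)\<^sup>2 \<partial>\<mu>) =
    (\<integral>\<^sup>+t\<in>{0<..}. (\<integral>\<^sup>+y. ennreal ((cmod (theta \<mu> s t f y))\<^sup>2 / t) \<partial>\<mu>) \<partial>lborel)"
proof -
  let ?g = "\<lambda>(t, y). ennreal ((cmod (theta \<mu> s t f y))\<^sup>2 / t powr 1) * indicator {0<..} t"
  interpret pair_sigma_finite lborel \<mu>
    using \<mu> by (intro pair_sigma_finite.intro sigma_finite_lborel)
  have "(\<integral>\<^sup>+x. (vertical_sf \<mu> s f x)\<^sup>2 \<partial>\<mu>) = (\<integral>\<^sup>+x. (\<integral>\<^sup>+t. ?g (t, x) \<partial>lborel) \<partial>\<mu>)"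
    by (auto simp: vertical_sf_def indicator_def intro!: nn_integral_cong)
  also have "\<dots> = (\<integral>\<^sup>+t. (\<integral>\<^sup>+x. ?g (t, x) \<partial>\<mu>) \<partial>lborel)"
    by (rule Fubini) (rule measurable_theta_density[OF assms])
  also have "\<dots> = (\<integral>\<^sup>+t\<in>{0<..}. (\<integral>\<^sup>+y. ennreal ((cmod (theta \<mu> s t f y))\<^sup>2 / t) \<partial>\<mu>) \<partial>lborel)"
    by (intro nn_integral_cong) (auto simp: indicator_def)
  finally show ?thesis .
qed

lemma nn_integral_conical_le_vertical:
  assumes \<mu>: "sigma_finite_measure \<mu>" and sets: "sets \<mu> = sets borel"
    and s: "measurable_kernels s" and f: "f \<in> borel_measurable \<mu>"
    and C: "\<And>y r. 0 < r \<Longrightarrow> emeasure \<mu> (ball y r) \<le> ennreal (C * r powr m)" and "0 < \<beta>" "0 \<le> C"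
  shows "(\<integral>\<^sup>+x. (conical_sf m \<mu> s \<beta> f x)\<^sup>2 \<partial>\<mu>)
      \<le> ennreal (C * \<beta> powr m) * (\<integral>\<^sup>+x. (vertical_sf \<mu> s f x)\<^sup>2 \<partial>\<mu>)"
proof -
  let ?V = "\<lambda>t. (\<integral>\<^sup>+y. ennreal ((cmod (theta \<mu> s t f y))\<^sup>2 / t) \<partial>\<mu>)"
  have meas: "(\<lambda>t. ?V t * indicator {0<..} t) \<in> borel_measurable lborel"
  proof -
    have "(\<lambda>t. \<integral>\<^sup>+y. (\<lambda>(t, y). ennreal ((cmod (theta \<mu> s t f y))\<^sup>2 / t powr 1) * indicator {0<..} t) (t, y) \<partial>\<mu>)
        \<in> borel_measurable lborel"
      using sigma_finite_measure.borel_measurable_nn_integral_fst[OF \<mu> measurable_theta_density[OF \<mu> sets s f]] .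
    also have "(\<lambda>t. \<integral>\<^sup>+y. (\<lambda>(t, y). ennreal ((cmod (theta \<mu> s t f y))\<^sup>2 / t powr 1) * indicator {0<..} t) (t, y) \<partial>\<mu>)
       = (\<lambda>t. ?V t * indicator {0<..} t)"
      by (auto simp: indicator_def fun_eq_iff intro!: nn_integral_cong)
    finally show ?thesis .
  qed
  have pt: "(\<integral>\<^sup>+y. ennreal ((cmod (theta \<mu> s t f y))\<^sup>2 / t powr (m + 1)) * emeasure \<mu> (ball y (\<beta> * t)) \<partial>\<mu>)
      \<le> ennreal (C * \<beta> powr m) * ?V t" if "t > 0" for t
  proof -
    have f': "(\<lambda>y. ennreal ((cmod (theta \<mu> s t f y))\<^sup>2 / t)) \<in> borel_measurable \<mu>"
      using measurable_Pair2[OF measurable_theta_density[OF \<mu> sets s f, of 1], of t] that by simp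
    have "(\<integral>\<^sup>+y. ennreal ((cmod (theta \<mu> s t f y))\<^sup>2 / t powr (m + 1)) * emeasure \<mu> (ball y (\<beta> * t)) \<partial>\<mu>)
      \<le> (\<integral>\<^sup>+y. ennreal (C * \<beta> powr m) * ennreal ((cmod (theta \<mu> s t f y))\<^sup>2 / t) \<partial>\<mu>)"
    proof (intro nn_integral_mono)
      fix y
      have "ennreal ((cmod (theta \<mu> s t f y))\<^sup>2 / t powr (m + 1)) * emeasure \<mu> (ball y (\<beta> * t))
         \<le> ennreal ((cmod (theta \<mu> s t f y))\<^sup>2 / t powr (m + 1)) * ennreal (C * (\<beta> * t) powr m)"
        using that \<open>0 < \<beta>\<close> by (intro mult_left_mono C) auto
      also have "\<dots> = ennreal (C * \<beta> powr m) * ennreal ((cmod (theta \<mu> s t f y))\<^sup>2 / t)"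
        using that \<open>0 < \<beta>\<close> \<open>0 \<le> C\<close>
        by (simp add: ennreal_mult[symmetric] powr_mult powr_add field_simps)
      finally show "ennreal ((cmod (theta \<mu> s t f y))\<^sup>2 / t powr (m + 1)) * emeasure \<mu> (ball y (\<beta> * t))
         \<le> ennreal (C * \<beta> powr m) * ennreal ((cmod (theta \<mu> s t f y))\<^sup>2 / t)" .
    qed
    also have "\<dots> = ennreal (C * \<beta> powr m) * ?V t"
      by (rule nn_integral_cmult[OF f'])
    finally show ?thesis .
  qed
  have "(\<integral>\<^sup>+x. (conical_sf m \<mu> s \<beta> f x)\<^sup>2 \<partial>\<mu>)
      \<le> (\<integral>\<^sup>+t. ennreal (C * \<beta> powr m) * (?V t * indicator {0<..} t) \<partial>lborel)"
    unfolding nn_integral_conical_sf[OF \<mu> sets s f]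
    by (intro nn_integral_mono) (use pt in \<open>auto simp: indicator_def\<close>)
  also have "\<dots> = ennreal (C * \<beta> powr m) * (\<integral>\<^sup>+x. (vertical_sf \<mu> s f x)\<^sup>2 \<partial>\<mu>)"
    unfolding nn_integral_vertical_sf[OF \<mu> sets s f] by (rule nn_integral_cmult[OF meas])
  finally show ?thesis .
qed

text \<open>
  Growth of exponent \<open>m\<close> bounds the weight, so square integrability passes from the vertical
  function to the conical functions of all apertures.
\<close>

lemma conical_in_L2_if_vertical_in_L2:
  assumes st: "standing_assumptions m \<alpha> \<mu> s" and V: "in_L2 \<mu> (vertical_sf \<mu> s f)"
    and f: "f \<in> borel_measurable \<mu>" and "0 < \<beta>"
  shows "in_L2 \<mu> (conical_sf m \<mu> s \<beta> f)"
proof -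
  interpret prob_space \<mu> using st by (simp add: standing_assumptions_def)
  have sets: "sets \<mu> = sets borel" and s: "measurable_kernels s" and "growth_condition m \<mu>"
    using st by (auto simp: standing_assumptions_def)
  then obtain C where C: "\<And>x r. r > 0 \<Longrightarrow> measure \<mu> (ball x r) \<le> C * r powr m"
    unfolding growth_condition_def by blast
  have "0 \<le> C"
    using C[of 1 0] order_trans[OF measure_nonneg] by fastforce
  have C': "emeasure \<mu> (ball y r) \<le> ennreal (C * r powr m)" if "0 < r" for y r
    using C[OF that] by (simp add: emeasure_eq_measure ennreal_leI)
  have "(\<integral>\<^sup>+x. (conical_sf m \<mu> s \<beta> f x)\<^sup>2 \<partial>\<mu>)
      \<le> ennreal (C * \<beta> powr m) * (\<integral>\<^sup>+x. (vertical_sf \<mu> s f x)\<^sup>2 \<partial>\<mu>)"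
    by (rule nn_integral_conical_le_vertical[OF _ sets s f C' \<open>0 < \<beta>\<close> \<open>0 \<le> C\<close>]) unfold_locales
  also have "\<dots> < \<infinity>"
    using V by (auto simp: in_L2_def L2_norm_def ennreal_sqrt_less_top_iff ennreal_mult_less_top)
  finally show ?thesis
    using measurable_conical_sf[OF _ sets s f] sigma_finite_measure_axioms
    by (auto simp: in_L2_def L2_norm_def ennreal_sqrt_less_top_iff)
qed

section \<open>Tent kernels with a prescribed length at each scale\<close>

text \<open>
  At scale \<open>t\<close> the kernel averages over distances up to \<open>2 h(t)\<close>, where \<open>h(t)\<close> may be much larger
  than \<open>t\<close>; the height \<open>\<surd>t / h(t)\<close> is, up to a constant, the largest one that the size
  condition with exponents \<open>m = \<alpha> = 1/2\<close> permits at such distances. Since division by zero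
  yields zero, \<open>h(t) = 0\<close> switches the scale \<open>t\<close> off.
\<close>

definition tent_kernel :: "(real \<Rightarrow> real) \<Rightarrow> real \<Rightarrow> real \<Rightarrow> real \<Rightarrow> complex" where
  "tent_kernel h t x y = complex_of_real (sqrt t / h t * max 0 (1 - \<bar>x - y\<bar> / (2 * h t)))"

lemma measurable_kernels_tent:
  assumes [measurable]: "h \<in> borel_measurable borel"
  shows "measurable_kernels (tent_kernel h)"
  unfolding measurable_kernels_def
proof (rule measurable_restrict_space1)
  have "(\<lambda>p. tent_kernel h (fst p) (fst (snd p)) (snd (snd p)))
      \<in> borel_measurable (borel \<Otimes>\<^sub>M (borel \<Otimes>\<^sub>M borel))"
    unfolding tent_kernel_def by measurable
  then show "(\<lambda>(t, x, y). tent_kernel h t x y) \<in> borel_measurable borel"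
    by (simp add: borel_prod case_prod_beta)
qed

lemma cmod_tent_kernel:
  assumes "0 \<le> h t" "0 < t"
  shows "cmod (tent_kernel h t x y) = sqrt t / h t * max 0 (1 - \<bar>x - y\<bar> / (2 * h t))"
proof -
  have "0 \<le> sqrt t / h t * max 0 (1 - \<bar>x - y\<bar> / (2 * h t))"
    using assms by simp
  then show ?thesis
    unfolding tent_kernel_def norm_of_real by (rule abs_of_nonneg)
qed

lemma size_condition_tent:
  assumes h: "\<And>t. 0 < t \<Longrightarrow> h t = 0 \<or> t \<le> h t"
  shows "size_condition (1/2) (1/2) (tent_kernel h)"
  unfolding size_condition_def
proof (intro exI[of _ 3] allI impI)
  fix x y t :: real assume t: "t > 0"
  show "cmod (tent_kernel h t x y) \<le> 3 * (t powr (1/2) / (t + \<bar>x - y\<bar>) powr (1/2 + 1/2))"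
  proof (cases "h t = 0 \<or> 2 * h t \<le> \<bar>x - y\<bar>")
    case True
    with h[OF t] t have "tent_kernel h t x y = 0"
      by (auto simp: tent_kernel_def field_simps max_def)
    then show ?thesis using t by simp
  next
    case False
    with h[OF t] t have *: "t \<le> h t" "0 < h t" "\<bar>x - y\<bar> < 2 * h t" by auto
    have "max 0 (1 - \<bar>x - y\<bar> / (2 * h t)) \<le> 1"
      using * by (simp add: max_def)
    then have "cmod (tent_kernel h t x y) \<le> sqrt t / h t * 1"
      unfolding cmod_tent_kernel[of h t, OF less_imp_le[OF *(2)] t] using * t by (intro mult_left_mono) auto
    also have "\<dots> = 3 * sqrt t / (3 * h t)" by simp
    also have "\<dots> \<le> 3 * sqrt t / (t + \<bar>x - y\<bar>)"
      using * t by (intro divide_left_mono) auto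
    finally show ?thesis using t by (simp add: powr_half_sqrt)
  qed
qed

text \<open>
  If both values vanish there is nothing to show; otherwise \<open>t + |x - y| \<le> 4 h(t)\<close>.
  The tent has slope \<open>\<surd>t / (2 h(t)\<^sup>2)\<close>, and half a power of \<open>|y - z|\<close> is given up against
  \<open>|y - z| < t \<le> h(t)\<close>.
\<close>

lemma holder_condition_tent:
  assumes h: "\<And>t. 0 < t \<Longrightarrow> h t = 0 \<or> t \<le> h t"
  shows "holder_condition (1/2) (1/2) (tent_kernel h)"
  unfolding holder_condition_def
proof (intro exI[of _ 2] allI impI)
  fix x y z t :: real assume t: "t > 0 \<and> \<bar>y - z\<bar> < t / 2"
  let ?\<phi> = "\<lambda>y. max 0 (1 - \<bar>x - y\<bar> / (2 * h t))"
  show "cmod (tent_kernel h t x y - tent_kernel h t x z)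
      \<le> 2 * (\<bar>y - z\<bar> powr (1/2) / (t + \<bar>x - y\<bar>) powr (1/2 + 1/2))"
  proof (cases "h t = 0 \<or> (2 * h t \<le> \<bar>x - y\<bar> \<and> 2 * h t \<le> \<bar>x - z\<bar>)")
    case True
    with h[of t] t have "tent_kernel h t x y = 0" "tent_kernel h t x z = 0"
      by (auto simp: tent_kernel_def field_simps max_def)
    then show ?thesis using t by simp
  next
    case False
    with h[of t] t have *: "t \<le> h t" "0 < h t" by auto
    moreover have "\<bar>x - y\<bar> \<le> \<bar>x - z\<bar> + \<bar>y - z\<bar>" by linarith
    ultimately have **: "t + \<bar>x - y\<bar> < 4 * h t" using False t by linarith
    have "\<bar>?\<phi> y - ?\<phi> z\<bar> \<le> \<bar>\<bar>x - y\<bar> / (2 * h t) - \<bar>x - z\<bar> / (2 * h t)\<bar>"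
      by linarith
    also have "\<dots> = \<bar>\<bar>x - y\<bar> - \<bar>x - z\<bar>\<bar> / (2 * h t)"
      using * by (simp add: diff_divide_distrib[symmetric])
    also have "\<dots> \<le> \<bar>y - z\<bar> / (2 * h t)"
      using * by (intro divide_right_mono) auto
    finally have \<phi>: "\<bar>?\<phi> y - ?\<phi> z\<bar> \<le> \<bar>y - z\<bar> / (2 * h t)" .
    have "tent_kernel h t x y - tent_kernel h t x z = of_real (sqrt t / h t * (?\<phi> y - ?\<phi> z))"
      unfolding tent_kernel_def of_real_diff[symmetric] right_diff_distrib ..
    then have "cmod (tent_kernel h t x y - tent_kernel h t x z) = sqrt t / h t * \<bar>?\<phi> y - ?\<phi> z\<bar>"
      unfolding norm_of_real using * t by (simp only: norm_of_real abs_mult) simp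
    also have "\<dots> \<le> sqrt t / h t * (\<bar>y - z\<bar> / (2 * h t))"
      using * t by (intro mult_left_mono \<phi>) auto
    also have "\<dots> = sqrt \<bar>y - z\<bar> * (sqrt t * sqrt \<bar>y - z\<bar> / h t) / (2 * h t)"
      by (simp add: mult_ac)
    also have "\<dots> \<le> sqrt \<bar>y - z\<bar> * 1 / (2 * h t)"
    proof -
      have "sqrt t * sqrt \<bar>y - z\<bar> \<le> sqrt t * sqrt t"
        using t by (intro mult_left_mono) auto
      also have "\<dots> \<le> h t" using * t by simp
      finally show ?thesis
        using * by (intro divide_right_mono mult_left_mono) auto
    qed
    also have "\<dots> = 2 * sqrt \<bar>y - z\<bar> / (4 * h t)" by simp
    also have "\<dots> \<le> 2 * sqrt \<bar>y - z\<bar> / (t + \<bar>x - y\<bar>)"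
      using * ** t by (intro divide_left_mono) auto
    finally show ?thesis using t by (simp add: powr_half_sqrt)
  qed
qed

text \<open>
  The Cauchy-Schwarz inequality for \<open>f\<close> against the indicator of \<open>A\<close>, obtained by integrating
  \<open>2 l f \<le> f\<^sup>2 + l\<^sup>2\<close> over \<open>A\<close> and optimising in \<open>l\<close>.
\<close>

lemma (in finite_measure) nn_integral_indicator_square_le:
  assumes [measurable]: "A \<in> sets M" "f \<in> borel_measurable M"
  shows "(\<integral>\<^sup>+x\<in>A. ennreal (f x) \<partial>M)\<^sup>2 \<le> emeasure M A * (\<integral>\<^sup>+x\<in>A. ennreal ((f x)\<^sup>2) \<partial>M)"
proof -
  let ?I1 = "\<integral>\<^sup>+x\<in>A. ennreal (f x) \<partial>M" and ?I2 = "\<integral>\<^sup>+x\<in>A. ennreal ((f x)\<^sup>2) \<partial>M"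
  have *: "2 * ennreal l * ?I1 \<le> ?I2 + ennreal (l\<^sup>2) * emeasure M A" if "0 \<le> l" for l
  proof -
    have "2 * ennreal l * ?I1 = (\<integral>\<^sup>+x\<in>A. 2 * ennreal l * ennreal (f x) \<partial>M)"
      by (subst nn_integral_cmult[symmetric]) (auto simp: mult_ac intro!: nn_integral_cong)
    also have "\<dots> \<le> (\<integral>\<^sup>+x. ennreal ((f x)\<^sup>2) * indicator A x + ennreal (l\<^sup>2) * indicator A x \<partial>M)"
    proof (intro nn_integral_mono)
      fix x
      have "2 * ennreal l * ennreal (f x) \<le> ennreal ((f x)\<^sup>2) + ennreal (l\<^sup>2)"
      proof -
        have "2 * ennreal l * ennreal (f x) = ennreal (2 * l * f x)"
          using that by (simp add: ennreal_mult' ennreal_mult'' mult_ac)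
        also have "\<dots> \<le> ennreal ((f x)\<^sup>2 + l\<^sup>2)"
          using sum_squares_bound[of l "f x"] by (intro ennreal_leI) simp
        finally show ?thesis by simp
      qed
      then show "2 * ennreal l * ennreal (f x) * indicator A x
          \<le> ennreal ((f x)\<^sup>2) * indicator A x + ennreal (l\<^sup>2) * indicator A x"
        by (auto simp: indicator_def)
    qed
    also have "\<dots> = ?I2 + ennreal (l\<^sup>2) * emeasure M A"
      by (subst nn_integral_add) (auto simp: nn_integral_cmult_indicator)
    finally show ?thesis .
  qed
  show ?thesis
  proof (cases "emeasure M A = 0")
    case True
    then have "?I1 = 0"
      by (intro nn_integral_null_set) (auto simp: null_sets_def)
    then show ?thesis by simp
  next
    case False
    then obtain a where a: "emeasure M A = ennreal a" "0 < a"
      by (metis emeasure_eq_measure ennreal_0 measure_nonneg order_le_less)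
    show ?thesis
    proof (cases "?I2 = \<infinity>")
      case True
      then show ?thesis using a by (simp add: ennreal_mult_top)
    next
      case False
      then obtain b where b: "?I2 = ennreal b" "0 \<le> b" by (cases ?I2) auto
      have "?I1 < \<infinity>"
        using *[of 1] a b by (auto simp: ennreal_mult_top top_unique less_top[symmetric])
      then obtain c where c: "?I1 = ennreal c" "0 \<le> c" by (cases ?I1) auto
      \<comment> \<open>The optimal \<open>l\<close> is the mean value of \<open>f\<close> over \<open>A\<close>.\<close>
      have "ennreal (2 * (c / a) * c) \<le> ennreal (b + (c / a)\<^sup>2 * a)"
      proof -
        have "ennreal (2 * (c / a) * c) = 2 * ennreal (c / a) * ?I1"
          using a c by (simp only: c(1) ennreal_mult divide_nonneg_pos mult_nonneg_nonneg zero_le_numeral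
              ennreal_numeral)
        also have "\<dots> \<le> ?I2 + ennreal ((c / a)\<^sup>2) * emeasure M A"
          using a c by (intro *) simp
        also have "\<dots> = ennreal (b + (c / a)\<^sup>2 * a)"
          using a b by (simp add: ennreal_mult)
        finally show ?thesis .
      qed
      then have "2 * (c / a) * c \<le> b + (c / a)\<^sup>2 * a"
        using a b c by (subst (asm) ennreal_le_iff) auto
      then have "c\<^sup>2 \<le> a * b"
        using a by (simp add: field_simps power2_eq_square)
      then show ?thesis
        unfolding a b c using a b c by (simp add: ennreal_power ennreal_mult[symmetric] ennreal_leI)
    qed
  qed
qed

lemma cmod_theta_le:
  "ennreal (cmod (theta \<mu> s t f x)) \<le> (\<integral>\<^sup>+y. ennreal (cmod (s t x y) * cmod (f y)) \<partial>\<mu>)"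
proof (cases "integrable \<mu> (\<lambda>y. s t x y * f y)")
  case True
  from integral_norm_bound_ennreal[OF this] show ?thesis
    by (simp add: theta_def norm_mult)
next
  case False
  then show ?thesis by (simp add: theta_def not_integrable_integral_eq)
qed

text \<open>
  Schur's test for the kernel \<open>\<surd>t / h(t)\<close> on \<open>|x - y| < 2 h(t)\<close>. With \<open>D\<close> of order \<open>\<surd>h(t)\<close>, as
  growth of exponent 1/2 guarantees, the operator norm squared is of order \<open>t / h(t)\<close>.
\<close>

lemma theta_tent_L2_bound:
  assumes "finite_measure \<mu>" and sets: "sets \<mu> = sets borel" and f: "f \<in> borel_measurable \<mu>"
    and D: "\<And>x. emeasure \<mu> (ball x (2 * h t)) \<le> ennreal D" and "0 \<le> D" and h: "0 < h t" and t: "0 < t"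
  shows "(\<integral>\<^sup>+x. ennreal ((cmod (theta \<mu> (tent_kernel h) t f x))\<^sup>2) \<partial>\<mu>)
       \<le> ennreal (t / (h t)\<^sup>2 * D\<^sup>2) * (\<integral>\<^sup>+y. ennreal ((cmod (f y))\<^sup>2) \<partial>\<mu>)"
proof -
  interpret finite_measure \<mu> by fact
  interpret P: pair_sigma_finite \<mu> \<mu> ..
  note [measurable_cong] = sets
  have [measurable]: "f \<in> borel_measurable borel"
    using f by (simp add: measurable_cong_sets[OF sets refl])
  have [measurable]: "ball x (2 * h t) \<in> sets borel" for x
    by simp
  let ?J = "\<lambda>x. \<integral>\<^sup>+y\<in>ball x (2 * h t). ennreal ((cmod (f y))\<^sup>2) \<partial>\<mu>"
  have J: "(\<lambda>(x, y). ennreal ((cmod (f y))\<^sup>2) * indicator (ball x (2 * h t)) y) \<in> borel_measurable (\<mu> \<Otimes>\<^sub>M \<mu>)"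
  proof -
    have "(\<lambda>p. ennreal ((cmod (f (snd p)))\<^sup>2) * indicator {p. dist (fst p) (snd p) < 2 * h t} p)
        \<in> borel_measurable (\<mu> \<Otimes>\<^sub>M \<mu>)"
      by measurable
    then show ?thesis
      by (simp add: case_prod_beta indicator_def)
  qed
  have pt: "ennreal ((cmod (theta \<mu> (tent_kernel h) t f x))\<^sup>2) \<le> ennreal (t / (h t)\<^sup>2 * D) * ?J x" for x
  proof -
    have "ennreal (cmod (theta \<mu> (tent_kernel h) t f x))
        \<le> (\<integral>\<^sup>+y. ennreal (cmod (tent_kernel h t x y) * cmod (f y)) \<partial>\<mu>)"
      by (rule cmod_theta_le)
    also have "\<dots> \<le> (\<integral>\<^sup>+y. ennreal (sqrt t / h t) * (ennreal (cmod (f y)) * indicator (ball x (2 * h t)) y) \<partial>\<mu>)"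
    proof (intro nn_integral_mono)
      fix y
      have "cmod (tent_kernel h t x y) \<le> sqrt t / h t * indicator (ball x (2 * h t)) y"
      proof (cases "dist x y < 2 * h t")
        case True
        have "max 0 (1 - \<bar>x - y\<bar> / (2 * h t)) \<le> 1"
          using h by (simp add: max_def)
        then have "sqrt t / h t * max 0 (1 - \<bar>x - y\<bar> / (2 * h t)) \<le> sqrt t / h t * 1"
          using h t by (intro mult_left_mono) auto
        with True show ?thesis
          using h t by (simp add: cmod_tent_kernel)
      next
        case False
        then show ?thesis
          using h t by (simp add: cmod_tent_kernel dist_real_def field_simps)
      qed
      then have "cmod (tent_kernel h t x y) * cmod (f y)
          \<le> sqrt t / h t * indicator (ball x (2 * h t)) y * cmod (f y)"
        by (intro mult_right_mono) auto
      then have "ennreal (cmod (tent_kernel h t x y) * cmod (f y))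
          \<le> ennreal (sqrt t / h t * indicator (ball x (2 * h t)) y * cmod (f y))"
        by (rule ennreal_leI)
      also have "\<dots> = ennreal (sqrt t / h t) * (ennreal (cmod (f y)) * indicator (ball x (2 * h t)) y)"
        using h t by (auto simp: indicator_def ennreal_mult[symmetric])
      finally show "ennreal (cmod (tent_kernel h t x y) * cmod (f y))
          \<le> ennreal (sqrt t / h t) * (ennreal (cmod (f y)) * indicator (ball x (2 * h t)) y)" .
    qed
    also have "\<dots> = ennreal (sqrt t / h t) * (\<integral>\<^sup>+y\<in>ball x (2 * h t). ennreal (cmod (f y)) \<partial>\<mu>)"
      by (rule nn_integral_cmult) measurable
    finally have "(ennreal (cmod (theta \<mu> (tent_kernel h) t f x)))\<^sup>2
        \<le> (ennreal (sqrt t / h t) * (\<integral>\<^sup>+y\<in>ball x (2 * h t). ennreal (cmod (f y)) \<partial>\<mu>))\<^sup>2"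
      by (rule power_mono) simp
    also have "\<dots> = ennreal (t / (h t)\<^sup>2) * (\<integral>\<^sup>+y\<in>ball x (2 * h t). ennreal (cmod (f y)) \<partial>\<mu>)\<^sup>2"
      using h t by (simp add: power_mult_distrib ennreal_power power_divide)
    also have "\<dots> \<le> ennreal (t / (h t)\<^sup>2) * (ennreal D * ?J x)"
      by (intro mult_left_mono order_trans[OF nn_integral_indicator_square_le] mult_right_mono D)
         (auto simp: sets)
    also have "\<dots> = ennreal (t / (h t)\<^sup>2 * D) * ?J x"
      using h t \<open>0 \<le> D\<close> by (simp only: ennreal_mult divide_nonneg_nonneg zero_le_power2 less_imp_le mult.assoc)
    finally show ?thesis by (simp add: ennreal_power)
  qed
  have "(\<integral>\<^sup>+x. ?J x \<partial>\<mu>) = (\<integral>\<^sup>+y. (\<integral>\<^sup>+x. ennreal ((cmod (f y))\<^sup>2) * indicator (ball x (2 * h t)) y \<partial>\<mu>) \<partial>\<mu>)"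
    using P.Fubini[OF J] by simp
  also have "\<dots> = (\<integral>\<^sup>+y. ennreal ((cmod (f y))\<^sup>2) * emeasure \<mu> (ball y (2 * h t)) \<partial>\<mu>)"
  proof (intro nn_integral_cong)
    fix y
    have "(\<integral>\<^sup>+x. ennreal ((cmod (f y))\<^sup>2) * indicator (ball x (2 * h t)) y \<partial>\<mu>)
       = (\<integral>\<^sup>+x. ennreal ((cmod (f y))\<^sup>2) * indicator (ball y (2 * h t)) x \<partial>\<mu>)"
      by (intro nn_integral_cong) (auto simp: indicator_def dist_commute)
    also have "\<dots> = ennreal ((cmod (f y))\<^sup>2) * emeasure \<mu> (ball y (2 * h t))"
      by (rule nn_integral_cmult_indicator) (simp add: sets)
    finally show "(\<integral>\<^sup>+x. ennreal ((cmod (f y))\<^sup>2) * indicator (ball x (2 * h t)) y \<partial>\<mu>)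
       = ennreal ((cmod (f y))\<^sup>2) * emeasure \<mu> (ball y (2 * h t))" .
  qed
  also have "\<dots> \<le> (\<integral>\<^sup>+y. ennreal D * ennreal ((cmod (f y))\<^sup>2) \<partial>\<mu>)"
    by (intro nn_integral_mono) (metis D mult.commute mult_right_mono zero_le)
  also have "\<dots> = ennreal D * (\<integral>\<^sup>+y. ennreal ((cmod (f y))\<^sup>2) \<partial>\<mu>)"
    by (rule nn_integral_cmult) measurable
  finally have JJ: "(\<integral>\<^sup>+x. ?J x \<partial>\<mu>) \<le> ennreal D * (\<integral>\<^sup>+y. ennreal ((cmod (f y))\<^sup>2) \<partial>\<mu>)" .
  have "(\<integral>\<^sup>+x. ennreal ((cmod (theta \<mu> (tent_kernel h) t f x))\<^sup>2) \<partial>\<mu>)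
      \<le> (\<integral>\<^sup>+x. ennreal (t / (h t)\<^sup>2 * D) * ?J x \<partial>\<mu>)"
    by (intro nn_integral_mono pt)
  also have "\<dots> = ennreal (t / (h t)\<^sup>2 * D) * (\<integral>\<^sup>+x. ?J x \<partial>\<mu>)"
    using borel_measurable_nn_integral_fst[OF J] by (intro nn_integral_cmult) simp
  also have "\<dots> \<le> ennreal (t / (h t)\<^sup>2 * D) * (ennreal D * (\<integral>\<^sup>+y. ennreal ((cmod (f y))\<^sup>2) \<partial>\<mu>))"
    by (intro mult_left_mono JJ) simp
  also have "\<dots> = ennreal (t / (h t)\<^sup>2 * D\<^sup>2) * (\<integral>\<^sup>+y. ennreal ((cmod (f y))\<^sup>2) \<partial>\<mu>)"
    using h t \<open>0 \<le> D\<close> by (simp add: ennreal_mult[symmetric] mult.assoc[symmetric] power2_eq_square)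
  finally show ?thesis .
qed

text \<open>
  The converse bound, because the tent is at least half its height on \<open>|x - y| \<le> h(t)\<close>.
\<close>

lemma theta_tent_one_ge:
  assumes "finite_measure \<mu>" and sets: "sets \<mu> = sets borel" and h: "0 < h t" and t: "0 < t"
    and c: "c \<le> measure \<mu> (cball x (h t))"
  shows "sqrt t / (2 * h t) * c \<le> cmod (theta \<mu> (tent_kernel h) t (\<lambda>_. 1) x)"
proof -
  interpret finite_measure \<mu> by fact
  note [measurable_cong] = sets
  let ?k = "\<lambda>y. sqrt t / h t * max 0 (1 - \<bar>x - y\<bar> / (2 * h t))"
  have int: "integrable \<mu> ?k"
  proof (rule integrable_const_bound)
    have "\<bar>?k y\<bar> \<le> sqrt t / h t" for y
    proof -
      have "max 0 (1 - \<bar>x - y\<bar> / (2 * h t)) \<le> 1" using h by (simp add: max_def)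
      then have "?k y \<le> sqrt t / h t * 1" using h t by (intro mult_left_mono) auto
      moreover have "0 \<le> ?k y" using h t by simp
      ultimately show ?thesis by simp
    qed
    then show "AE y in \<mu>. norm (?k y) \<le> sqrt t / h t" by simp
  qed measurable
  have "sqrt t / (2 * h t) * c \<le> sqrt t / (2 * h t) * measure \<mu> (cball x (h t))"
    using h t by (intro mult_left_mono c) auto
  also have "\<dots> = (\<integral>y. sqrt t / (2 * h t) * indicator (cball x (h t)) y \<partial>\<mu>)"
    by (simp add: sets)
  also have "\<dots> \<le> (\<integral>y. ?k y \<partial>\<mu>)"
  proof (rule integral_mono[OF _ int])
    show "integrable \<mu> (\<lambda>y. sqrt t / (2 * h t) * indicator (cball x (h t)) y)"
      by (intro integrable_mult_right integrable_real_indicator) (auto simp: sets emeasure_eq_measure)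
    fix y
    show "sqrt t / (2 * h t) * indicator (cball x (h t)) y \<le> ?k y"
    proof (cases "\<bar>x - y\<bar> \<le> h t")
      case True
      then have "1 / 2 \<le> max 0 (1 - \<bar>x - y\<bar> / (2 * h t))"
        using h by (simp add: max_def field_simps)
      then have "sqrt t / h t * (1 / 2) \<le> ?k y" using h t by (intro mult_left_mono) auto
      then show ?thesis using True by (simp add: dist_real_def)
    qed (use h t in \<open>simp add: dist_real_def\<close>)
  qed
  also have "\<dots> \<le> cmod (complex_of_real (\<integral>y. ?k y \<partial>\<mu>))"
    unfolding norm_of_real by (rule abs_ge_self)
  also have "complex_of_real (\<integral>y. ?k y \<partial>\<mu>) = theta \<mu> (tent_kernel h) t (\<lambda>_. 1) x"
    unfolding theta_def tent_kernel_def mult_1_right by (rule integral_complex_of_real[symmetric])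
  finally show ?thesis .
qed

section \<open>Cantor measures with prescribed free binary digits\<close>

text \<open>
  For a set \<open>P\<close> of positions, the Cantor measure studied here is the law of a random number in
  \<open>[0, 1]\<close> whose binary digits at positions in \<open>P\<close> are independent and uniform, the other digits
  being 0. Instead of a sequence of coin tosses one uniform real \<open>u\<close> supplies the randomness: its
  binary digits are spread out, in order, over the positions in \<open>P\<close>. All estimates of the measure
  then become statements about a single explicit function. \<open>free_digits P n\<close> counts the free
  positions among the first \<open>n\<close>, so that an admissible choice of the first \<open>n\<close> digits has
  probability \<open>2\<close> to the power \<open>- free_digits P n\<close>; positions are numbered from 0.
\<close>

primrec free_digits :: "(nat \<Rightarrow> bool) \<Rightarrow> nat \<Rightarrow> nat" where
  "free_digits P 0 = 0"
| "free_digits P (Suc n) = free_digits P n + of_bool (P n)"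

definition spread_digit :: "(nat \<Rightarrow> bool) \<Rightarrow> nat \<Rightarrow> real \<Rightarrow> int" where
  "spread_digit P n u =
     (if P n then \<lfloor>2 ^ Suc (free_digits P n) * u\<rfloor> - 2 * \<lfloor>2 ^ free_digits P n * u\<rfloor> else 0)"

definition spread :: "(nat \<Rightarrow> bool) \<Rightarrow> real \<Rightarrow> real" where
  "spread P u = (\<Sum>n. of_int (spread_digit P n u) / 2 ^ Suc n)"

text \<open>
  The integer whose binary expansion consists of the first \<open>n\<close> spread digits.
\<close>

primrec spread_prefix :: "(nat \<Rightarrow> bool) \<Rightarrow> nat \<Rightarrow> real \<Rightarrow> int" where
  "spread_prefix P 0 u = 0"
| "spread_prefix P (Suc n) u = 2 * spread_prefix P n u + spread_digit P n u"

lemma floor_double_bounds: "2 * \<lfloor>x\<rfloor> \<le> \<lfloor>2 * x\<rfloor>" "\<lfloor>2 * x\<rfloor> \<le> 2 * \<lfloor>x\<rfloor> + 1" for x :: real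
  by linarith+

lemma spread_digit_bounds: "0 \<le> spread_digit P n u" "spread_digit P n u \<le> 1"
  using floor_double_bounds[of "2 ^ free_digits P n * u"] by (auto simp: spread_digit_def mult.assoc)

lemma measurable_spread [measurable]: "spread P \<in> borel_measurable borel"
  unfolding spread_def spread_digit_def by measurable

lemma spread_prefix_sum: "(\<Sum>i<n. of_int (spread_digit P i u) / 2 ^ Suc i) = real_of_int (spread_prefix P n u) / 2 ^ n"
  by (induction n) (auto simp: field_simps)

lemma spread_bounds:
  "of_int (spread_prefix P n u) / 2 ^ n \<le> spread P u"
  "spread P u \<le> (of_int (spread_prefix P n u) + 1) / 2 ^ n"
proof -
  let ?d = "\<lambda>i. real_of_int (spread_digit P i u) / 2 ^ Suc i"
  have d: "0 \<le> ?d i" "?d i \<le> (1/2) ^ Suc i" for i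
    using spread_digit_bounds[of P i u] by (auto simp: power_divide divide_right_mono)
  have geo: "(\<lambda>i. (1/2) ^ Suc (i + n) :: real) sums (1 / 2 ^ n)"
    using sums_mult[OF power_half_series, of "1 / 2 ^ n"] by (simp add: power_add power_divide mult_ac)
  have s: "summable ?d"
    by (rule summable_comparison_test'[where g = "\<lambda>i. (1/2) ^ Suc i" and N = 0])
       (use d in \<open>auto simp: abs_of_nonneg spread_digit_bounds intro: sums_summable power_half_series\<close>)
  have eq: "spread P u = (\<Sum>i. ?d (i + n)) + of_int (spread_prefix P n u) / 2 ^ n"
    unfolding spread_def suminf_split_initial_segment[OF s, of n] spread_prefix_sum ..
  have s': "summable (\<lambda>i. ?d (i + n))"
    using s by (rule summable_ignore_initial_segment)
  have "0 \<le> (\<Sum>i. ?d (i + n))"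
    by (intro suminf_nonneg s' d)
  then show "of_int (spread_prefix P n u) / 2 ^ n \<le> spread P u"
    using eq by simp
  have "(\<Sum>i. ?d (i + n)) \<le> (\<Sum>i. (1/2) ^ Suc (i + n))"
    by (intro suminf_le s' d sums_summable[OF geo])
  then show "spread P u \<le> (of_int (spread_prefix P n u) + 1) / 2 ^ n"
    using eq sums_unique[OF geo] by (simp add: add_divide_distrib)
qed

lemma spread_prefix_cong:
  fixes u v :: real
  assumes "\<lfloor>2 ^ free_digits P n * u\<rfloor> = \<lfloor>2 ^ free_digits P n * v\<rfloor>"
  shows "spread_prefix P n u = spread_prefix P n v"
  using assms
proof (induction n)
  case (Suc n)
  show ?case
  proof (cases "P n")
    case True
    let ?x = "2 ^ free_digits P n * u" and ?y = "2 ^ free_digits P n * v"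
    have *: "\<lfloor>2 * ?x\<rfloor> = \<lfloor>2 * ?y\<rfloor>" using Suc.prems True by (simp add: mult.assoc)
    have "\<lfloor>?x\<rfloor> = \<lfloor>?y\<rfloor>"
      using floor_double_bounds[of ?x] floor_double_bounds[of ?y] * by linarith
    with * Suc.IH True show ?thesis by (simp add: spread_digit_def mult.assoc)
  qed (use Suc in \<open>simp add: spread_digit_def\<close>)
qed simp

text \<open>
  Inserting zeros between digits can only increase differences. By induction on \<open>n\<close>, because a
  free position doubles both differences and adds the same amount to each, and a fixed one doubles
  the right-hand side only.
\<close>

lemma spread_prefix_expanding:
  assumes "0 \<le> u" "u \<le> v" "v < 1"
  shows "\<lfloor>2 ^ free_digits P n * v\<rfloor> - \<lfloor>2 ^ free_digits P n * u\<rfloor> \<le> spread_prefix P n v - spread_prefix P n u"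
proof (induction n)
  case 0
  from assms have "\<lfloor>u\<rfloor> = 0" "\<lfloor>v\<rfloor> = 0" by (simp_all add: floor_eq_iff)
  then show ?case by simp
next
  case (Suc n)
  have "\<lfloor>2 ^ free_digits P n * u\<rfloor> \<le> \<lfloor>2 ^ free_digits P n * v\<rfloor>"
    using assms by (intro floor_mono) simp
  with Suc show ?case by (auto simp: spread_digit_def)
qed

text \<open>
  The geometry of \<^const>\<open>spread\<close> in one direction: parameters sharing the digits that fill the first
  \<open>n\<close> positions have close images. The next lemma is the converse; since it speaks of distances
  rather than digits, a factor of 2 is lost.
\<close>

lemma spread_close:
  fixes u v :: real
  assumes "\<lfloor>2 ^ free_digits P n * u\<rfloor> = \<lfloor>2 ^ free_digits P n * v\<rfloor>"
  shows "\<bar>spread P u - spread P v\<bar> \<le> 1 / 2 ^ n"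
  using spread_bounds[where n = n and u = u and P = P] spread_bounds[where n = n and u = v and P = P] spread_prefix_cong[OF assms]
  by (simp add: add_divide_distrib)

lemma spread_separated:
  assumes "0 \<le> u" "u < 1" "0 \<le> v" "v < 1" and close: "\<bar>spread P u - spread P v\<bar> < 1 / 2 ^ n"
  shows "\<bar>u - v\<bar> < 2 / 2 ^ free_digits P n"
proof -
  have *: "v - u < 2 / 2 ^ free_digits P n"
    if "0 \<le> u" "u \<le> v" "v < 1" "spread P v - spread P u < 1 / 2 ^ n" for u v
  proof (rule ccontr)
    \<comment> \<open>Integer parts that differ by 1 would not suffice: the images of neighbouring dyadic
      intervals may touch.\<close>
    assume "\<not> ?thesis"
    then have "2 \<le> 2 ^ free_digits P n * v - 2 ^ free_digits P n * u"
      by (simp add: field_simps)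
    then have "2 \<le> \<lfloor>2 ^ free_digits P n * v\<rfloor> - \<lfloor>2 ^ free_digits P n * u\<rfloor>" by linarith
    then have "2 \<le> spread_prefix P n v - spread_prefix P n u"
      using spread_prefix_expanding[OF that(1-3), of P n] by linarith
    then have "real_of_int (spread_prefix P n u) + 2 \<le> of_int (spread_prefix P n v)" by linarith
    then have "(real_of_int (spread_prefix P n u) + 2) / 2 ^ n \<le> of_int (spread_prefix P n v) / 2 ^ n"
      by (simp add: divide_right_mono)
    then show False
      using spread_bounds[where n = n and u = u and P = P] spread_bounds[where n = n and u = v and P = P] that(4) by (simp add: add_divide_distrib)
  qed
  show ?thesis
  proof (cases "u \<le> v")
    case True
    then show ?thesis using *[of u v] assms by linarith
  next
    case False
    then show ?thesis using *[of v u] assms by linarith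
  qed
qed

definition spread_measure :: "(nat \<Rightarrow> bool) \<Rightarrow> real measure" where
  "spread_measure P = distr (uniform_measure lborel {0..<1}) borel (spread P)"

lemma sets_spread_measure [simp]: "sets (spread_measure P) = sets borel"
  by (simp add: spread_measure_def)

lemma prob_space_spread_measure: "prob_space (spread_measure P)"
  unfolding spread_measure_def
  by (intro prob_space.prob_space_distr prob_space_uniform_measure) auto

lemma sets_spread_preimage:
  assumes "A \<in> sets borel"
  shows "{u\<in>{0..<1}. spread P u \<in> A} \<in> sets lborel"
proof -
  have "{0..<1} \<inter> spread P -` A \<in> sets borel"
    using measurable_sets[OF measurable_spread assms, of P] by simp
  also have "{0..<1} \<inter> spread P -` A = {u\<in>{0..<1}. spread P u \<in> A}" by auto
  finally show ?thesis by simp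
qed

lemma emeasure_spread_measure:
  assumes [measurable]: "A \<in> sets borel"
  shows "emeasure (spread_measure P) A = emeasure lborel {u\<in>{0..<1}. spread P u \<in> A}"
proof -
  have "emeasure (spread_measure P) A = emeasure (uniform_measure lborel {0..<1}) (spread P -` A)"
    unfolding spread_measure_def by (subst emeasure_distr) auto
  also have "\<dots> = emeasure lborel ({0..<1} \<inter> spread P -` A)"
  proof -
    have "spread P -` A \<in> sets borel"
      using measurable_sets[OF measurable_spread assms, of P] by simp
    then show ?thesis by (subst emeasure_uniform_measure) (auto simp: divide_ennreal_def)
  qed
  also have "{0..<1} \<inter> spread P -` A = {u\<in>{0..<1}. spread P u \<in> A}" by auto
  finally show ?thesis .
qed

lemma spread_measure_ball_le:
  assumes "2 * r \<le> 1 / 2 ^ n"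
  shows "measure (spread_measure P) (ball x r) \<le> 4 / 2 ^ free_digits P n"
proof -
  interpret prob_space "spread_measure P" by (rule prob_space_spread_measure)
  let ?A = "{u\<in>{0..<1}. spread P u \<in> ball x r}" and ?d = "2 / 2 ^ free_digits P n :: real"
  have "emeasure lborel ?A \<le> ennreal (2 * ?d)"
  proof (cases "?A = {}")
    case False
    then obtain v where v: "v \<in> ?A" by blast
    have "?A \<subseteq> {v - ?d..v + ?d}"
    proof
      fix u assume u: "u \<in> ?A"
      then have "\<bar>spread P u - spread P v\<bar> < 1 / 2 ^ n"
        using v assms by (auto simp: dist_real_def)
      then have "\<bar>u - v\<bar> < ?d"
        using u v by (intro spread_separated) auto
      then show "u \<in> {v - ?d..v + ?d}" by auto
    qed
    then have "emeasure lborel ?A \<le> emeasure lborel {v - ?d..v + ?d}"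
      by (intro emeasure_mono) auto
    also have "\<dots> = ennreal (2 * ?d)" by simp
    finally show ?thesis .
  next
    case True
    then show ?thesis by (simp only: emeasure_empty zero_le)
  qed
  then have "emeasure (spread_measure P) (ball x r) \<le> ennreal (2 * ?d)"
    by (simp add: emeasure_spread_measure)
  then show ?thesis by (simp add: emeasure_eq_measure)
qed

text \<open>
  Almost every point is an image \<open>spread P u\<close>, and all \<open>v\<close> sharing the first
  \<open>free_digits P n\<close> digits of \<open>u\<close> have images within \<open>2\<^sup>-\<^sup>n\<close>.
\<close>

lemma AE_spread_measure_cball_ge:
  "AE x in spread_measure P. \<forall>n. 1 / 2 ^ free_digits P n \<le> measure (spread_measure P) (cball x (1 / 2 ^ n))"
proof -
  interpret prob_space "spread_measure P" by (rule prob_space_spread_measure)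
  have "1 / 2 ^ free_digits P n \<le> measure (spread_measure P) (cball (spread P u) (1 / 2 ^ n))"
    if u: "u \<in> {0..<1}" for u n
  proof -
    let ?c = "free_digits P n"
    define k where "k = \<lfloor>2 ^ ?c * u\<rfloor>"
    have k: "0 \<le> k" "k < 2 ^ ?c"
      using u by (auto simp: floor_less_iff k_def)
    have "real_of_int (k + 1) \<le> real_of_int (2 ^ ?c)"
      unfolding of_int_le_iff using k by simp
    then have k': "real_of_int k + 1 \<le> 2 ^ ?c"
      by simp
    have "{real_of_int k / 2 ^ ?c..<(real_of_int k + 1) / 2 ^ ?c} \<subseteq> {v\<in>{0..<1}. spread P v \<in> cball (spread P u) (1 / 2 ^ n)}"
    proof
      fix v assume v: "v \<in> {real_of_int k / 2 ^ ?c..<(real_of_int k + 1) / 2 ^ ?c}"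
      then have "\<lfloor>2 ^ ?c * v\<rfloor> = k"
        by (intro floor_unique) (auto simp: field_simps)
      then have "\<bar>spread P u - spread P v\<bar> \<le> 1 / 2 ^ n"
        by (intro spread_close) (simp add: k_def)
      moreover have "0 \<le> v"
        using v k by (auto intro: order_trans[rotated])
      moreover have "v < 1"
      proof -
        have "v < (real_of_int k + 1) / 2 ^ ?c" using v by simp
        also have "\<dots> \<le> 1" using k' by simp
        finally show ?thesis .
      qed
      ultimately show "v \<in> {v\<in>{0..<1}. spread P v \<in> cball (spread P u) (1 / 2 ^ n)}"
        by (auto simp: dist_real_def)
    qed
    then have "emeasure lborel {real_of_int k / 2 ^ ?c..<(real_of_int k + 1) / 2 ^ ?c}
        \<le> emeasure (spread_measure P) (cball (spread P u) (1 / 2 ^ n))"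
      unfolding emeasure_spread_measure[OF borel_closed[OF closed_cball]] by (rule emeasure_mono) (intro sets_spread_preimage borel_closed closed_cball)
    then show ?thesis
      by (simp add: emeasure_eq_measure diff_divide_distrib[symmetric] divide_right_mono)
  qed
  then have "AE u in uniform_measure lborel {0..<1::real}.
     \<forall>n. 1 / 2 ^ free_digits P n \<le> measure (spread_measure P) (cball (spread P u) (1 / 2 ^ n))"
    by (intro AE_uniform_measureI) auto
  moreover have "{x. \<forall>n. 1 / 2 ^ free_digits P n \<le> measure (spread_measure P) (cball x (1 / 2 ^ n))} \<in> sets borel"
  proof -
    have "(\<lambda>x. emeasure (spread_measure P) (cball x (1 / 2 ^ n))) \<in> borel_measurable borel" for n
    proof -
      have "{p::real \<times> real. dist (fst p) (snd p) \<le> 1 / 2 ^ n} \<in> sets (borel \<Otimes>\<^sub>M borel)"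
        unfolding borel_prod by (intro borel_closed closed_Collect_le continuous_intros)
      then have "(\<lambda>x. emeasure (spread_measure P) (Pair x -` {p. dist (fst p) (snd p) \<le> 1 / 2 ^ n}))
          \<in> borel_measurable borel"
        by (intro measurable_emeasure_Pair) (simp add: sets_pair_measure_cong[OF refl sets_spread_measure])
      then show ?thesis by (simp add: vimage_def cball_def)
    qed
    from borel_measurable_enn2real[OF this] have [measurable]:
      "(\<lambda>x. measure (spread_measure P) (cball x (1 / 2 ^ n))) \<in> borel_measurable borel" for n
      unfolding measure_def .
    show ?thesis by measurable
  qed
  ultimately show ?thesis
    unfolding spread_measure_def[of P] by (subst AE_distr_iff) (auto simp: spread_measure_def[symmetric])
qed

lemma dyadic_bracket:
  fixes r :: real
  assumes "0 < r" "r \<le> 1 / 2 ^ a"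
  obtains i where "1 / 2 ^ Suc (a + i) < r" "r \<le> 1 / 2 ^ (a + i)"
proof -
  obtain k where k: "(1 / 2) ^ k < r"
    using real_arch_pow_inv[OF \<open>0 < r\<close>, of "1 / 2"] by auto
  have "(1 / 2 :: real) ^ Suc (a + k) \<le> (1 / 2) ^ k"
    by (intro power_decreasing) auto
  with k have ex: "1 / 2 ^ Suc (a + k) < r" by (simp add: power_divide)
  define i where "i = (LEAST i. 1 / 2 ^ Suc (a + i) < r)"
  have i: "1 / 2 ^ Suc (a + i) < r"
    unfolding i_def by (rule LeastI) (rule ex)
  moreover have "r \<le> 1 / 2 ^ (a + i)"
  proof (cases i)
    case (Suc l)
    then have "\<not> 1 / 2 ^ Suc (a + l) < r"
      unfolding i_def by (intro not_less_Least) (simp add: i_def)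
    with Suc show ?thesis by simp
  qed (use assms in simp)
  ultimately show ?thesis by (rule that)
qed

text \<open>
  A ball of radius comparable to \<open>2\<^sup>-\<^sup>n\<close> has mass at most a constant times \<open>2\<close> to the power
  \<open>- free_digits P n\<close>, which is at most \<open>2\<close> to the power \<open>- n/2\<close> if at least half of the digits are free.
\<close>

lemma spread_measure_growth:
  assumes c: "\<And>n. n \<le> 2 * free_digits P n" and "0 < r"
  shows "measure (spread_measure P) (ball x r) \<le> 8 * sqrt r"
proof (cases "2 * r \<le> 1")
  case True
  then obtain n where n: "1 / 2 ^ Suc n < 2 * r" "2 * r \<le> 1 / 2 ^ n"
    using dyadic_bracket[of "2 * r" 0] \<open>0 < r\<close> by auto
  have "measure (spread_measure P) (ball x r) \<le> 4 / 2 ^ free_digits P n"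
    by (rule spread_measure_ball_le[OF n(2)])
  also have "\<dots> \<le> 8 * sqrt r"
  proof (rule power2_le_imp_le)
    have "(4 / 2 ^ free_digits P n)\<^sup>2 = 16 / (2::real) ^ (2 * free_digits P n)"
      by (simp add: power_divide power_mult power2_eq_square flip: power_mult_distrib)
    also have "\<dots> \<le> 16 / 2 ^ n"
      by (intro divide_left_mono power_increasing c) auto
    also have "\<dots> \<le> 64 * r" using n by (simp add: field_simps)
    finally show "(4 / 2 ^ free_digits P n)\<^sup>2 \<le> (8 * sqrt r)\<^sup>2"
      using \<open>0 < r\<close> by (simp add: power_mult_distrib)
  qed (use \<open>0 < r\<close> in simp)
  finally show ?thesis .
next
  case False
  have "measure (spread_measure P) (ball x r) \<le> 1"
    by (rule prob_space.prob_le_1[OF prob_space_spread_measure])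
  also have "1 \<le> 8 * sqrt (1 / 4)" by (simp add: real_sqrt_divide)
  also have "\<dots> \<le> 8 * sqrt r"
    using False by (intro mult_left_mono real_sqrt_le_mono) auto
  finally show ?thesis .
qed

section \<open>Long runs of free digits\<close>

text \<open>
  The \<open>j\<close>-th run consists of the \<open>j + 1\<close> positions from \<open>j(j+1)\<close> on and is followed by a gap of
  equal length. When a run starts, exactly half of the digits so far are free, so that a
  neighbourhood of length \<open>L\<close>, one unit of the last digit, carries the full mass \<open>\<surd>L\<close> that
  growth allows. During the run the measure looks like a multiple of Lebesgue measure, and smaller
  intervals are much lighter than growth allows. The gap then restores the balance for the next run.
\<close>

definition long_runs :: "nat \<Rightarrow> bool" where
  "long_runs n \<longleftrightarrow> (\<exists>j. j * (j + 1) \<le> n \<and> n < (j + 1) * (j + 1))"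

lemma long_runs_free: "i \<le> j \<Longrightarrow> long_runs (j * (j + 1) + i)"
  unfolding long_runs_def by (intro exI[of _ j]) auto

lemma long_runs_fixed:
  assumes "i \<le> j" shows "\<not> long_runs ((j + 1) * (j + 1) + i)"
proof
  assume "long_runs ((j + 1) * (j + 1) + i)"
  then obtain k where k: "k * (k + 1) \<le> (j + 1) * (j + 1) + i" "(j + 1) * (j + 1) + i < (k + 1) * (k + 1)"
    unfolding long_runs_def by blast
  show False
  proof (cases "k \<le> j")
    case True
    then have "(k + 1) * (k + 1) \<le> (j + 1) * (j + 1)" by (intro mult_le_mono) auto
    with k show ?thesis by linarith
  next
    case False
    then have "(j + 1) * (j + 2) \<le> k * (k + 1)" by (intro mult_le_mono) auto
    with k assms show ?thesis by simp
  qed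
qed

lemma free_digits_in_run:
  "i \<le> j + 1 \<Longrightarrow> free_digits long_runs (j * (j + 1) + i) = free_digits long_runs (j * (j + 1)) + i"
proof (induction i)
  case (Suc i)
  then show ?case using long_runs_free[of i j] by simp
qed simp

lemma free_digits_in_gap:
  "i \<le> j + 1 \<Longrightarrow>
    free_digits long_runs ((j + 1) * (j + 1) + i) = free_digits long_runs (j * (j + 1)) + (j + 1)"
proof (induction i)
  case 0
  have eq: "(j + 1) * (j + 1) = j * (j + 1) + (j + 1)" by simp
  show ?case by (simp only: add_0_right eq free_digits_in_run[OF order_refl])
next
  case (Suc i)
  then show ?case using long_runs_fixed[of i j] by simp
qed

lemma free_digits_run_start: "2 * free_digits long_runs (j * (j + 1)) = j * (j + 1)"
proof (induction j)
  case (Suc j)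
  have "Suc j * (Suc j + 1) = (j + 1) * (j + 1) + (j + 1)" by simp
  then have "free_digits long_runs (Suc j * (Suc j + 1)) = free_digits long_runs (j * (j + 1)) + (j + 1)"
    by (simp only: free_digits_in_gap[OF order_refl])
  with Suc show ?case by simp
qed simp

lemma free_digits_long_runs_ge: "n \<le> 2 * free_digits long_runs n"
proof -
  have "\<exists>j i. n = j * (j + 1) + i \<and> i < 2 * (j + 1)"
  proof (induction n)
    case 0
    show ?case by (intro exI[of _ 0]) simp
  next
    case (Suc n)
    then obtain j i where ji: "n = j * (j + 1) + i" "i < 2 * (j + 1)" by blast
    show ?case
    proof (cases "Suc i < 2 * (j + 1)")
      case True
      then show ?thesis using ji by (intro exI[of _ j] exI[of _ "Suc i"]) simp
    next
      case False
      then have "Suc i = 2 * (j + 1)" using ji by linarith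
      then show ?thesis using ji by (intro exI[of _ "Suc j"] exI[of _ 0]) simp
    qed
  qed
  then obtain j i where n: "n = j * (j + 1) + i" "i < 2 * (j + 1)" by blast
  show ?thesis
  proof (cases "i \<le> j + 1")
    case True
    then show ?thesis
      using free_digits_in_run[OF True] free_digits_run_start[of j] n by simp
  next
    case False
    then obtain l where l: "i = j + 1 + l" "l \<le> j + 1" using n by (metis add_le_cancel_left le_add_diff_inverse less_imp_le linear mult_2)
    then have "n = (j + 1) * (j + 1) + l" using n by simp
    then show ?thesis
      using free_digits_in_gap[OF l(2)] free_digits_run_start[of j] l(2) by simp
  qed
qed

section \<open>Square functions of tent kernels\<close>

text \<open>
  By the Tonelli identity, the squared norm is an integral over \<open>t\<close> of three factors: the operator
  norm squared \<open>t / h(t)\<close> of \<open>\<theta>\<^sub>t\<close>, the measure \<open>\<mu>(B(y, t))\<close>, of order \<open>t / \<surd>h(t)\<close> by thinness, and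
  \<open>t\<close> to the power \<open>-3/2\<close>. Their product is the integrand of the last assumption.
\<close>

lemma conical_tent_bounded_on_L2:
  assumes "prob_space \<mu>" and sets: "sets \<mu> = sets borel"
    and h [measurable]: "h \<in> borel_measurable borel" and h_nonneg: "\<And>t. 0 < t \<Longrightarrow> 0 \<le> h t"
    and growth: "\<And>x r. 0 < r \<Longrightarrow> measure \<mu> (ball x r) \<le> C * sqrt r"
    and thin: "\<And>x t. 0 < t \<Longrightarrow> 0 < h t \<Longrightarrow> measure \<mu> (ball x t) \<le> D * t / sqrt (h t)"
    and "0 \<le> C" "0 \<le> D"
    and K: "(\<integral>\<^sup>+t\<in>{0<..}. ennreal (sqrt t / (h t * sqrt (h t))) \<partial>lborel) < \<infinity>"
  shows "bounded_on_L2 \<mu> (conical_sf (1/2) \<mu> (tent_kernel h) 1)"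
proof -
  interpret prob_space \<mu> by fact
  obtain k where k: "(\<integral>\<^sup>+t\<in>{0<..}. ennreal (sqrt t / (h t * sqrt (h t))) \<partial>lborel) = ennreal k" "0 \<le> k"
    using K by (cases "\<integral>\<^sup>+t\<in>{0<..}. ennreal (sqrt t / (h t * sqrt (h t))) \<partial>lborel") auto
  define B where "B = 2 * C\<^sup>2 * D"
  have "0 \<le> B" using \<open>0 \<le> D\<close> by (simp add: B_def)
  have main: "(\<integral>\<^sup>+x. (conical_sf (1/2) \<mu> (tent_kernel h) 1 f x)\<^sup>2 \<partial>\<mu>)
      \<le> ennreal (B * k) * (\<integral>\<^sup>+y. ennreal ((cmod (f y))\<^sup>2) \<partial>\<mu>)"
    if f: "f \<in> borel_measurable \<mu>" for f
  proof -
    let ?N = "\<integral>\<^sup>+y. ennreal ((cmod (f y))\<^sup>2) \<partial>\<mu>"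
    have pt: "(\<integral>\<^sup>+y. ennreal ((cmod (theta \<mu> (tent_kernel h) t f y))\<^sup>2 / t powr (1/2 + 1)) * emeasure \<mu> (ball y (1 * t)) \<partial>\<mu>)
        \<le> ennreal (B * (sqrt t / (h t * sqrt (h t)))) * ?N" if t: "0 < t" for t
    proof (cases "h t = 0")
      case True
      then show ?thesis by (simp add: theta_def tent_kernel_def)
    next
      case False
      with h_nonneg[OF t] have ht: "0 < h t" by simp
      define w where "w = t powr (1/2 + 1)"
      have w: "0 < w" "w = t * sqrt t"
        using t unfolding w_def powr_add by (simp_all add: powr_half_sqrt)
      have "(\<integral>\<^sup>+y. ennreal ((cmod (theta \<mu> (tent_kernel h) t f y))\<^sup>2 / w) * emeasure \<mu> (ball y (1 * t)) \<partial>\<mu>)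
        \<le> (\<integral>\<^sup>+y. ennreal (D * t / sqrt (h t) / w) * ennreal ((cmod (theta \<mu> (tent_kernel h) t f y))\<^sup>2) \<partial>\<mu>)"
      proof (intro nn_integral_mono)
        fix y
        have "ennreal ((cmod (theta \<mu> (tent_kernel h) t f y))\<^sup>2 / w) * emeasure \<mu> (ball y (1 * t))
            = ennreal ((cmod (theta \<mu> (tent_kernel h) t f y))\<^sup>2 / w * measure \<mu> (ball y t))"
          unfolding emeasure_eq_measure mult_1 using w by (intro ennreal_mult[symmetric]) auto
        also have "\<dots> \<le> ennreal ((cmod (theta \<mu> (tent_kernel h) t f y))\<^sup>2 / w * (D * t / sqrt (h t)))"
          using w by (intro ennreal_leI mult_left_mono thin t ht) auto
        also have "(cmod (theta \<mu> (tent_kernel h) t f y))\<^sup>2 / w * (D * t / sqrt (h t))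
            = (D * t / sqrt (h t) / w) * (cmod (theta \<mu> (tent_kernel h) t f y))\<^sup>2"
          by (simp only: times_divide_eq_left times_divide_eq_right mult.commute)
        also have "ennreal \<dots> = ennreal (D * t / sqrt (h t) / w) * ennreal ((cmod (theta \<mu> (tent_kernel h) t f y))\<^sup>2)"
          using w t ht \<open>0 \<le> D\<close> by (intro ennreal_mult) auto
        finally show "ennreal ((cmod (theta \<mu> (tent_kernel h) t f y))\<^sup>2 / w) * emeasure \<mu> (ball y (1 * t))
          \<le> ennreal (D * t / sqrt (h t) / w) * ennreal ((cmod (theta \<mu> (tent_kernel h) t f y))\<^sup>2)" .
      qed
      also have "\<dots> = ennreal (D * t / sqrt (h t) / w) * (\<integral>\<^sup>+y. ennreal ((cmod (theta \<mu> (tent_kernel h) t f y))\<^sup>2) \<partial>\<mu>)"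
      proof (rule nn_integral_cmult)
        have "(\<lambda>y. indicator {0<..} t *\<^sub>R theta \<mu> (tent_kernel h) t f y) \<in> borel_measurable \<mu>"
          using measurable_Pair2[OF measurable_theta[OF sigma_finite_measure_axioms sets measurable_kernels_tent[OF h] f], of t]
          by simp
        with t have [measurable]: "(\<lambda>y. theta \<mu> (tent_kernel h) t f y) \<in> borel_measurable \<mu>" by simp
        show "(\<lambda>y. ennreal ((cmod (theta \<mu> (tent_kernel h) t f y))\<^sup>2)) \<in> borel_measurable \<mu>" by measurable
      qed
      also have "\<dots> \<le> ennreal (D * t / sqrt (h t) / w) * (ennreal (t / (h t)\<^sup>2 * (C * sqrt (2 * h t))\<^sup>2) * ?N)"
        using growth[of "2 * h t"] ht t \<open>0 \<le> C\<close>
        by (intro mult_left_mono theta_tent_L2_bound finite_measure_axioms sets f)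
           (auto simp: emeasure_eq_measure ennreal_leI)
      also have "\<dots> = ennreal ((D * t / sqrt (h t) / w) * (t / (h t)\<^sup>2 * (C * sqrt (2 * h t))\<^sup>2)) * ?N"
        using w t ht \<open>0 \<le> D\<close> by (subst ennreal_mult) (auto simp: mult.assoc)
      also have "(D * t / sqrt (h t) / w) * (t / (h t)\<^sup>2 * (C * sqrt (2 * h t))\<^sup>2) = B * (sqrt t / (h t * sqrt (h t)))"
        using t ht by (simp add: w B_def field_simps power2_eq_square)
      finally show ?thesis unfolding w_def .
    qed
    have "(\<integral>\<^sup>+x. (conical_sf (1/2) \<mu> (tent_kernel h) 1 f x)\<^sup>2 \<partial>\<mu>)
        \<le> (\<integral>\<^sup>+t. ennreal (sqrt t / (h t * sqrt (h t))) * indicator {0<..} t * (ennreal B * ?N) \<partial>lborel)"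
      unfolding nn_integral_conical_sf[OF sigma_finite_measure_axioms sets measurable_kernels_tent[OF h] f]
    proof (intro nn_integral_mono)
      fix t
      show "(\<integral>\<^sup>+y. ennreal ((cmod (theta \<mu> (tent_kernel h) t f y))\<^sup>2 / t powr (1/2 + 1)) * emeasure \<mu> (ball y (1 * t)) \<partial>\<mu>)
          * indicator {0<..} t
        \<le> ennreal (sqrt t / (h t * sqrt (h t))) * indicator {0<..} t * (ennreal B * ?N)"
      proof (cases "0 < t")
        case True
        have "ennreal (B * (sqrt t / (h t * sqrt (h t)))) = ennreal (sqrt t / (h t * sqrt (h t))) * ennreal B"
          using h_nonneg[OF True] \<open>0 \<le> B\<close> True by (subst ennreal_mult[symmetric]) (auto simp: mult_ac)
        with pt[OF True] True show ?thesis by (simp add: mult.assoc)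
      qed simp
    qed
    also have "\<dots> = ennreal k * (ennreal B * ?N)"
      unfolding k(1)[symmetric] by (rule nn_integral_multc) measurable
    also have "\<dots> = ennreal (B * k) * ?N"
      using \<open>0 \<le> B\<close> k by (simp add: ennreal_mult mult_ac)
    finally show ?thesis .
  qed
  show ?thesis
    unfolding bounded_on_L2_def
  proof (intro exI[of _ "sqrt (B * k)"] ballI impI)
    fix f :: "real \<Rightarrow> complex" assume "f \<in> borel_measurable \<mu>"
    from ennreal_sqrt_mono[OF main[OF this]]
    show "L2_norm \<mu> (conical_sf (1/2) \<mu> (tent_kernel h) 1 f)
        \<le> ennreal (sqrt (B * k)) * L2_norm \<mu> (\<lambda>x. ennreal (cmod (f x)))"
      using ennreal_sqrt_mult_power2[of "sqrt (B * k)"] \<open>0 \<le> B\<close> k by (simp add: L2_norm_def ennreal_power)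
  qed
qed

text \<open>
  The vertical square function of 1 is infinite almost everywhere: it integrates
  \<open>|\<theta>\<^sub>t 1(x)|\<^sup>2 / t\<close>, which is at least \<open>1 / (4 h(t))\<close> where the measure is thick.
\<close>

lemma vertical_tent_unbounded_on_L2:
  assumes "prob_space \<mu>" and sets: "sets \<mu> = sets borel"
    and h [measurable]: "h \<in> borel_measurable borel" and h_nonneg: "\<And>t. 0 < t \<Longrightarrow> 0 \<le> h t"
    and thick: "AE x in \<mu>. \<forall>t>0. 0 < h t \<longrightarrow> sqrt (h t) \<le> measure \<mu> (cball x (h t))"
    and div: "(\<integral>\<^sup>+t\<in>{0<..}. ennreal (1 / h t) \<partial>lborel) = \<infinity>"
  shows "\<not> bounded_on_L2 \<mu> (vertical_sf \<mu> (tent_kernel h))"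
proof
  interpret prob_space \<mu> by fact
  have V: "(vertical_sf \<mu> (tent_kernel h) (\<lambda>_. 1) x)\<^sup>2 = \<infinity>"
    if x: "\<forall>t>0. 0 < h t \<longrightarrow> sqrt (h t) \<le> measure \<mu> (cball x (h t))" for x
  proof -
    have "\<infinity> = ennreal (1/4) * (\<integral>\<^sup>+t\<in>{0<..}. ennreal (1 / h t) \<partial>lborel)"
      unfolding div by (simp add: ennreal_mult_top)
    also have "\<dots> = (\<integral>\<^sup>+t. ennreal (1/4) * (ennreal (1 / h t) * indicator {0<..} t) \<partial>lborel)"
      by (rule nn_integral_cmult[symmetric]) measurable
    also have "\<dots> \<le> (\<integral>\<^sup>+t\<in>{0<..}. ennreal ((cmod (theta \<mu> (tent_kernel h) t (\<lambda>_. 1) x))\<^sup>2 / t) \<partial>lborel)"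
    proof (intro nn_integral_mono)
      fix t
      show "ennreal (1/4) * (ennreal (1 / h t) * indicator {0<..} t)
          \<le> ennreal ((cmod (theta \<mu> (tent_kernel h) t (\<lambda>_. 1) x))\<^sup>2 / t) * indicator {0<..} t"
      proof (cases "0 < t \<and> 0 < h t")
        case True
        then have t: "0 < t" and ht: "0 < h t" by auto
        have "sqrt t / (2 * h t) * sqrt (h t) \<le> cmod (theta \<mu> (tent_kernel h) t (\<lambda>_. 1) x)"
          using x t ht by (intro theta_tent_one_ge finite_measure_axioms sets) auto
        then have "(sqrt t / (2 * h t) * sqrt (h t))\<^sup>2 \<le> (cmod (theta \<mu> (tent_kernel h) t (\<lambda>_. 1) x))\<^sup>2"
          using t ht by (intro power_mono) auto
        then have "(sqrt t / (2 * h t) * sqrt (h t))\<^sup>2 / t \<le> (cmod (theta \<mu> (tent_kernel h) t (\<lambda>_. 1) x))\<^sup>2 / t"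
          using t by (intro divide_right_mono) auto
        moreover have "(sqrt t / (2 * h t) * sqrt (h t))\<^sup>2 / t = 1/4 * (1 / h t)"
          using t ht by (simp add: power_mult_distrib power_divide power2_eq_square[of "h t"] field_simps)
        ultimately have "ennreal (1/4 * (1 / h t)) \<le> ennreal ((cmod (theta \<mu> (tent_kernel h) t (\<lambda>_. 1) x))\<^sup>2 / t)"
          by (intro ennreal_leI) simp
        then show ?thesis using True by (simp only: ennreal_mult') (simp add: ennreal_mult[symmetric])
      next
        case False
        then show ?thesis using h_nonneg[of t] by (cases "0 < t") (auto simp: not_less)
      qed
    qed
    also have "\<dots> = (vertical_sf \<mu> (tent_kernel h) (\<lambda>_. 1) x)\<^sup>2"
      by (simp add: vertical_sf_def)
    finally show ?thesis by (simp add: top_unique)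
  qed
  have "(\<integral>\<^sup>+x. (vertical_sf \<mu> (tent_kernel h) (\<lambda>_. 1) x)\<^sup>2 \<partial>\<mu>) = (\<integral>\<^sup>+x. \<infinity> \<partial>\<mu>)"
    using thick by (intro nn_integral_cong_AE) (auto simp: V elim: eventually_mono)
  also have "\<dots> = \<infinity>"
    by (simp add: emeasure_space_1)
  finally have top: "L2_norm \<mu> (vertical_sf \<mu> (tent_kernel h) (\<lambda>_. 1)) = \<infinity>"
    by (simp add: L2_norm_def ennreal_sqrt_def)
  have one: "L2_norm \<mu> (\<lambda>x. ennreal (cmod 1)) = 1"
    by (simp add: L2_norm_def ennreal_sqrt_def emeasure_space_1)
  assume "bounded_on_L2 \<mu> (vertical_sf \<mu> (tent_kernel h))"
  then obtain C where C: "\<And>f. f \<in> borel_measurable \<mu> \<Longrightarrow> L2_norm \<mu> (\<lambda>x. ennreal (cmod (f x))) < \<infinity> \<Longrightarrow>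
        L2_norm \<mu> (vertical_sf \<mu> (tent_kernel h) f) \<le> ennreal C * L2_norm \<mu> (\<lambda>x. ennreal (cmod (f x)))"
    unfolding bounded_on_L2_def by blast
  from C[of "\<lambda>_. 1"] show False
    unfolding one top by (simp add: top_unique)
qed

section \<open>Choice of the active scales\<close>

text \<open>
  On the \<open>j\<close>-th set of active scales \<open>t / h(t)\<close> is of order \<open>1 / (j+1)\<close>, where \<open>h(t)\<close> is the length at
  which the \<open>j\<close>-th run of free digits starts. It contributes an amount of order \<open>1 / (j+1)\<close> to the
  vertical square function, a divergent series, and of order \<open>(j+1)\<close> to the power \<open>-3/2\<close> to the
  conical one, the additional square root being the thinness of the measure. The run is long enough
  to contain all active scales, since \<open>j + 1 \<le> 2\<^sup>j\<close>.
\<close>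

definition active_length :: "nat \<Rightarrow> real" where
  "active_length j = 1 / 2 ^ (j * (j + 1))"

definition active_scales :: "nat \<Rightarrow> real set" where
  "active_scales j = {active_length j / (4 * (real j + 1))<..active_length j / (2 * (real j + 1))}"

definition scale_length :: "real \<Rightarrow> real" where
  "scale_length t = (\<Sum>j. indicator (active_scales j) t * active_length j)"

lemma active_length_pos: "0 < active_length j"
  by (simp add: active_length_def)

lemma active_scales_disjoint:
  assumes "i < j" shows "active_scales i \<inter> active_scales j = {}"
proof -
  have "(i + 1) * (i + 2) \<le> j * (j + 1)"
    using assms by (intro mult_le_mono) auto
  then have "i * (i + 1) + 2 * (i + 1) \<le> j * (j + 1)" by simp
  then have "active_length j \<le> 1 / 2 ^ (i * (i + 1) + 2 * (i + 1))"
    unfolding active_length_def by (intro divide_left_mono power_increasing) auto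
  also have "\<dots> = active_length i / 4 ^ (i + 1)"
  proof -
    have "(2::real) ^ (2 * (i + 1)) = 4 ^ (i + 1)" by (simp only: power_mult) simp
    then show ?thesis
      unfolding active_length_def power_add[of _ "i * (i + 1)"] by simp
  qed
  also have "\<dots> \<le> active_length i / (4 * (real i + 1))"
  proof -
    have "real i + 1 \<le> 4 ^ i"
      by (induction i) auto
    then have "4 * (real i + 1) \<le> 4 ^ (i + 1)" by simp
    then show ?thesis
      using active_length_pos[of i] by (intro divide_left_mono) (auto intro: mult_pos_pos)
  qed
  finally have "active_length j \<le> active_length i / (4 * (real i + 1))" .
  moreover have "active_length j / (2 * (real j + 1)) \<le> active_length j"
    using active_length_pos[of j] by (simp add: field_simps)
  ultimately show ?thesis
    unfolding active_scales_def by auto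
qed

lemma disjoint_active_scales: "disjoint_family active_scales"
  unfolding disjoint_family_on_def
  by (metis active_scales_disjoint inf_commute linorder_neqE_nat)

lemma scale_length_eq:
  assumes "t \<in> active_scales j" shows "scale_length t = active_length j"
proof -
  have "(\<lambda>i. indicator (active_scales i) t * active_length i) = (\<lambda>i. if i = j then active_length i else 0)"
    using assms disjoint_active_scales by (auto simp: fun_eq_iff indicator_def disjoint_family_on_def)
  then show ?thesis
    unfolding scale_length_def by (simp add: sums_unique[OF sums_single, symmetric])
qed

lemma scale_length_eq_0: "(\<And>j. t \<notin> active_scales j) \<Longrightarrow> scale_length t = 0"
  by (simp add: scale_length_def)

lemma sets_active_scales [measurable]: "active_scales j \<in> sets borel"
  by (simp add: active_scales_def)

lemma measurable_scale_length [measurable]: "scale_length \<in> borel_measurable borel"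
  unfolding scale_length_def by measurable

lemma active_scales_bounds:
  assumes "t \<in> active_scales j"
  shows "0 < t" "active_length j < 4 * (real j + 1) * t" "2 * (real j + 1) * t \<le> active_length j" "t \<le> active_length j"
proof -
  show *: "active_length j < 4 * (real j + 1) * t" "2 * (real j + 1) * t \<le> active_length j"
    using assms by (auto simp: active_scales_def field_simps)
  then have "0 < 4 * (real j + 1) * t"
    using active_length_pos[of j] by linarith
  then show t: "0 < t" by (simp add: zero_less_mult_iff)
  have "1 * t \<le> 2 * (real j + 1) * t"
    using t by (intro mult_right_mono) auto
  with * show "t \<le> active_length j" by linarith
qed

lemma scale_length_pos_iff: "0 < scale_length t \<longleftrightarrow> (\<exists>j. t \<in> active_scales j)"
  by (metis active_length_pos less_irrefl scale_length_eq scale_length_eq_0)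

lemma scale_length_cases: "scale_length t = 0 \<or> t \<le> scale_length t"
  by (metis active_scales_bounds(4) scale_length_eq scale_length_eq_0)

lemma scale_length_nonneg: "0 \<le> scale_length t"
  by (metis active_length_pos less_imp_le order_refl scale_length_eq scale_length_eq_0)

lemma emeasure_active_scales: "emeasure lborel (active_scales j) = ennreal (active_length j / (4 * (real j + 1)))"
proof -
  have "active_length j / (4 * (real j + 1)) \<le> active_length j / (2 * (real j + 1))"
    using active_length_pos[of j] by (intro divide_left_mono) auto
  moreover have "active_length j / (2 * x) - active_length j / (4 * x) = active_length j / (4 * x)" for x :: real
    by (cases "x = 0") (simp_all add: field_simps)
  ultimately show ?thesis
    unfolding active_scales_def by (simp only: emeasure_lborel_Ioc)
qed

lemma conical_scale_integral_finite:
  "(\<integral>\<^sup>+t\<in>{0<..}. ennreal (sqrt t / (scale_length t * sqrt (scale_length t))) \<partial>lborel) < \<infinity>"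
proof -
  let ?c = "\<lambda>j. 1 / (sqrt (real (j + 1)) * active_length j)"
  have "(\<integral>\<^sup>+t\<in>{0<..}. ennreal (sqrt t / (scale_length t * sqrt (scale_length t))) \<partial>lborel)
      \<le> (\<integral>\<^sup>+t. (\<Sum>j. ennreal (?c j) * indicator (active_scales j) t) \<partial>lborel)"
  proof (intro nn_integral_mono)
    fix t
    show "ennreal (sqrt t / (scale_length t * sqrt (scale_length t))) * indicator {0<..} t
        \<le> (\<Sum>j. ennreal (?c j) * indicator (active_scales j) t)"
    proof (cases "\<exists>j. t \<in> active_scales j")
      case True
      then obtain j where j: "t \<in> active_scales j" by blast
      note t = active_scales_bounds[OF j]
      have "t * (j + 1) \<le> active_length j"
      proof -
        have "t * (real j + 1) \<le> 2 * (real j + 1) * t" using t(1) by simp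
        with t(3) show ?thesis by (simp add: add.commute)
      qed
      then have "sqrt t * sqrt (j + 1) \<le> sqrt (active_length j)"
        unfolding real_sqrt_mult[symmetric] by (rule real_sqrt_le_mono)
      then have "sqrt t / (active_length j * sqrt (active_length j)) \<le> ?c j"
        using active_length_pos[of j] by (simp add: field_simps)
      then have "ennreal (sqrt t / (scale_length t * sqrt (scale_length t))) * indicator {0<..} t \<le> ennreal (?c j)"
        using t(1) by (simp add: scale_length_eq[OF j] ennreal_leI)
      also have "\<dots> = (\<Sum>j. ennreal (?c j) * indicator (active_scales j) t)"
        by (rule suminf_cmult_indicator[symmetric, OF disjoint_active_scales j])
      finally show ?thesis .
    next
      case False
      then show ?thesis by (simp add: scale_length_eq_0)
    qed
  qed
  also have "\<dots> = (\<Sum>j. ennreal (?c j) * emeasure lborel (active_scales j))"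
    by (subst nn_integral_suminf) (auto simp: nn_integral_cmult_indicator)
  also have "\<dots> = (\<Sum>j. ennreal (1/4 * real (Suc j) powr (-3/2)))"
  proof (intro suminf_cong)
    fix j
    have "?c j * (active_length j / (4 * (real j + 1))) = 1/4 * real (Suc j) powr (-3/2)"
    proof -
      have "real (Suc j) powr (-3/2) = 1 / (real (Suc j) powr (1 + 1/2))"
        by (simp add: powr_minus_divide flip: minus_divide_left)
      also have "real (Suc j) powr (1 + 1/2) = real (Suc j) * sqrt (real (Suc j))"
        by (subst powr_add) (simp add: powr_half_sqrt)
      finally show ?thesis
        using active_length_pos[of j] by (simp add: field_simps)
    qed
    then show "ennreal (?c j) * emeasure lborel (active_scales j) = ennreal (1/4 * real (Suc j) powr (-3/2))"
      using active_length_pos[of j] unfolding emeasure_active_scales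
      by (subst ennreal_mult[symmetric]) auto
  qed
  also have "\<dots> < \<infinity>"
  proof -
    have "summable (\<lambda>j. 1/4 * real (Suc j) powr (-3/2))"
      by (intro summable_mult) (subst summable_Suc_iff, simp add: summable_real_powr_iff)
    then show ?thesis
      by (subst suminf_ennreal2) auto
  qed
  finally show ?thesis .
qed

lemma vertical_scale_integral_infinite:
  "(\<integral>\<^sup>+t\<in>{0<..}. ennreal (1 / scale_length t) \<partial>lborel) = \<infinity>"
proof -
  have "(\<integral>\<^sup>+t\<in>{0<..}. ennreal (1 / scale_length t) \<partial>lborel)
      = (\<integral>\<^sup>+t. (\<Sum>j. ennreal (1 / active_length j) * indicator (active_scales j) t) \<partial>lborel)"
  proof (intro nn_integral_cong)
    fix t
    show "ennreal (1 / scale_length t) * indicator {0<..} t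
        = (\<Sum>j. ennreal (1 / active_length j) * indicator (active_scales j) t)"
    proof (cases "\<exists>j. t \<in> active_scales j")
      case True
      then obtain j where j: "t \<in> active_scales j" by blast
      have "ennreal (1 / scale_length t) * indicator {0<..} t = ennreal (1 / active_length j)"
        using active_scales_bounds(1)[OF j] by (simp add: scale_length_eq[OF j])
      also have "\<dots> = (\<Sum>j. ennreal (1 / active_length j) * indicator (active_scales j) t)"
        by (rule suminf_cmult_indicator[symmetric, OF disjoint_active_scales j])
      finally show ?thesis .
    qed (simp add: scale_length_eq_0)
  qed
  also have "\<dots> = (\<Sum>j. ennreal (1 / active_length j) * emeasure lborel (active_scales j))"
    by (subst nn_integral_suminf) (auto simp: nn_integral_cmult_indicator)
  also have "\<dots> = (\<Sum>j. ennreal (1/4 * inverse (real (Suc j))))"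
  proof (intro suminf_cong)
    fix j
    have "1 / active_length j * (active_length j / (4 * (real j + 1))) = 1/4 * inverse (real (Suc j))"
      using active_length_pos[of j] by (simp add: field_simps)
    then show "ennreal (1 / active_length j) * emeasure lborel (active_scales j) = ennreal (1/4 * inverse (real (Suc j)))"
      using active_length_pos[of j] unfolding emeasure_active_scales
      by (subst ennreal_mult[symmetric]) auto
  qed
  also have "\<dots> = \<infinity>"
  proof (rule ccontr)
    assume "\<not> ?thesis"
    then have "summable (\<lambda>j. 1/4 * inverse (real (Suc j)))"
      by (intro summable_suminf_not_top) auto
    then have "summable (\<lambda>j. inverse (real (Suc j)))"
      by simp
    then show False
      using not_summable_harmonic[where 'a = real] summable_Suc_iff[of "\<lambda>n. inverse (real n)"] by simp
  qed
  finally show ?thesis .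
qed

section \<open>Thinness and thickness of the long-run measure at the active scales\<close>

text \<open>
  At the start of a run exactly half of the digits are free.
\<close>

lemma sqrt_active_length: "sqrt (active_length j) = 1 / 2 ^ free_digits long_runs (j * (j + 1))"
proof -
  have "(2::real) ^ (j * (j + 1)) = (2 ^ free_digits long_runs (j * (j + 1)))\<^sup>2"
    by (metis free_digits_run_start mult.commute power_mult)
  then show ?thesis by (simp only: active_length_def real_sqrt_divide real_sqrt_one real_sqrt_abs) simp
qed

text \<open>
  An active scale \<open>t\<close> lies \<open>i \<le> j\<close> binary digits inside the \<open>j\<close>-th run, where all digits are free, so
  halving a radius halves the mass.
\<close>

lemma long_runs_measure_thin:
  assumes "0 < scale_length t"
  shows "measure (spread_measure long_runs) (ball x t) \<le> 16 * t / sqrt (scale_length t)"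
proof -
  obtain j where j: "t \<in> active_scales j"
    using assms scale_length_pos_iff by blast
  note t = active_scales_bounds[OF j]
  let ?n = "j * (j + 1)" and ?c = "free_digits long_runs (j * (j + 1))"
  have L: "active_length j = 1 / 2 ^ ?n" "sqrt (active_length j) = 1 / 2 ^ ?c"
    by (rule active_length_def, rule sqrt_active_length)
  have "2 * t \<le> 2 * (real j + 1) * t" using t(1) by (intro mult_right_mono) auto
  then have "2 * t \<le> 1 / 2 ^ ?n" using t(3) L by linarith
  then obtain i where i: "1 / 2 ^ Suc (?n + i) < 2 * t" "2 * t \<le> 1 / 2 ^ (?n + i)"
    using dyadic_bracket[of "2 * t" ?n] t(1) by auto
  \<comment> \<open>The scale \<open>t\<close> has not yet passed the end of the run.\<close>
  have "i \<le> j"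
  proof (rule ccontr)
    assume "\<not> i \<le> j"
    then have "(1::real) / 2 ^ (?n + i) \<le> 1 / 2 ^ (?n + (j + 1))"
      by (intro divide_left_mono power_increasing) auto
    also have "\<dots> = active_length j / 2 ^ (j + 1)"
      by (simp add: L power_add)
    also have "\<dots> \<le> active_length j / (2 * (real j + 1))"
    proof -
      have "real j + 1 \<le> 2 ^ j"
        by (induction j) auto
      then have "2 * (real j + 1) \<le> 2 ^ (j + 1)" by simp
      then show ?thesis
        using active_length_pos[of j] by (intro divide_left_mono) auto
    qed
    also have "\<dots> < 2 * t"
      using t(2) by (simp add: field_simps)
    finally show False using i(2) by simp
  qed
  have "measure (spread_measure long_runs) (ball x t) \<le> 4 / 2 ^ free_digits long_runs (?n + i)"
    by (rule spread_measure_ball_le[OF i(2)])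
  also have "\<dots> = 4 / (2 ^ ?c * 2 ^ i)"
    using \<open>i \<le> j\<close> by (simp only: free_digits_in_run power_add trans_le_add1)
  also have "\<dots> \<le> 16 * t * 2 ^ ?c"
  proof -
    have "1 < 4 * t * (2 ^ ?n * 2 ^ i)"
      using i(1) by (simp add: power_add field_simps)
    also have "(2::real) ^ ?n = 2 ^ ?c * 2 ^ ?c"
      by (metis free_digits_run_start mult_2 power_add)
    finally show ?thesis by (simp add: field_simps)
  qed
  also have "\<dots> = 16 * t / sqrt (scale_length t)"
    unfolding scale_length_eq[OF j] L(2) by simp
  finally show ?thesis .
qed

lemma AE_long_runs_measure_thick:
  "AE x in spread_measure long_runs. \<forall>t>0. 0 < scale_length t \<longrightarrow>
     sqrt (scale_length t) \<le> measure (spread_measure long_runs) (cball x (scale_length t))"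
  using AE_spread_measure_cball_ge[of long_runs]
proof (rule eventually_mono, intro allI impI)
  fix x t
  assume x: "\<forall>n. 1 / 2 ^ free_digits long_runs n \<le> measure (spread_measure long_runs) (cball x (1 / 2 ^ n))"
    and "0 < scale_length t"
  then obtain j where j: "t \<in> active_scales j"
    using scale_length_pos_iff by blast
  show "sqrt (scale_length t) \<le> measure (spread_measure long_runs) (cball x (scale_length t))"
    using x[rule_format, of "j * (j + 1)"]
    unfolding scale_length_eq[OF j] sqrt_active_length[symmetric] active_length_def[symmetric] .
qed

section \<open>The counterexample\<close>

lemma exists_conical_bounded_vertical_unbounded:
  "\<exists>m \<alpha> \<mu> s. standing_assumptions m \<alpha> \<mu> s
            \<and> bounded_on_L2 \<mu> (conical_sf m \<mu> s 1)
            \<and> \<not> bounded_on_L2 \<mu> (vertical_sf \<mu> s)"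
proof (intro exI conjI)
  let ?\<mu> = "spread_measure long_runs" and ?s = "tent_kernel scale_length"
  have growth: "measure ?\<mu> (ball x r) \<le> 8 * sqrt r" if "0 < r" for x r
    by (rule spread_measure_growth[OF free_digits_long_runs_ge that])
  show "standing_assumptions (1/2) (1/2) ?\<mu> ?s"
    unfolding standing_assumptions_def
  proof (intro conjI)
    show "growth_condition (1/2) ?\<mu>"
      unfolding growth_condition_def using growth by (intro exI[of _ 8]) (simp add: powr_half_sqrt)
    show "size_condition (1/2) (1/2) ?s" "holder_condition (1/2) (1/2) ?s"
      by (intro size_condition_tent holder_condition_tent scale_length_cases)+
  qed (simp_all add: prob_space_spread_measure measurable_kernels_tent)
  show "bounded_on_L2 ?\<mu> (conical_sf (1/2) ?\<mu> ?s 1)"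
    by (rule conical_tent_bounded_on_L2[where C = 8 and D = 16])
       (rule prob_space_spread_measure sets_spread_measure measurable_scale_length growth
          long_runs_measure_thin scale_length_nonneg conical_scale_integral_finite zero_le_numeral | assumption)+
  show "\<not> bounded_on_L2 ?\<mu> (vertical_sf ?\<mu> ?s)"
    by (rule vertical_tent_unbounded_on_L2)
       (rule prob_space_spread_measure sets_spread_measure measurable_scale_length scale_length_nonneg
          AE_long_runs_measure_thick vertical_scale_integral_infinite)+
qed

theorem corollary1p7:
  shows "(\<forall>m \<alpha> \<mu> s. standing_assumptions m \<alpha> \<mu> s
            \<and> bounded_on_L2 \<mu> (conical_sf m \<mu> s 1)
            \<and> (\<forall>\<beta>>1. \<not> in_L2 \<mu> (conical_sf m \<mu> s \<beta> (\<lambda>_. 1)))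
          \<longrightarrow> \<not> in_L2 \<mu> (vertical_sf \<mu> s (\<lambda>_. 1)))
       \<and> (\<exists>m \<alpha> \<mu> s. standing_assumptions m \<alpha> \<mu> s
            \<and> bounded_on_L2 \<mu> (conical_sf m \<mu> s 1)
            \<and> \<not> bounded_on_L2 \<mu> (vertical_sf \<mu> s))"
proof
  show "\<forall>m \<alpha> \<mu> s. standing_assumptions m \<alpha> \<mu> s
            \<and> bounded_on_L2 \<mu> (conical_sf m \<mu> s 1)
            \<and> (\<forall>\<beta>>1. \<not> in_L2 \<mu> (conical_sf m \<mu> s \<beta> (\<lambda>_. 1)))
          \<longrightarrow> \<not> in_L2 \<mu> (vertical_sf \<mu> s (\<lambda>_. 1))"
  proof (intro allI impI notI)
    fix m \<alpha> \<mu> s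
    assume "standing_assumptions m \<alpha> \<mu> s
            \<and> bounded_on_L2 \<mu> (conical_sf m \<mu> s 1)
            \<and> (\<forall>\<beta>>1. \<not> in_L2 \<mu> (conical_sf m \<mu> s \<beta> (\<lambda>_. 1)))"
      and "in_L2 \<mu> (vertical_sf \<mu> s (\<lambda>_. 1))"
    then show False
      using conical_in_L2_if_vertical_in_L2[of m \<alpha> \<mu> s "\<lambda>_. 1" 2] by auto
  qed
qed (rule exists_conical_bounded_vertical_unbounded)

end
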